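(* Let $A\in\mathcal{M}_n(\mathbb{C})$ be half-normal. Then the following are equivalent. (1) $A$ is unitarily equivalent to a weighted permutation. (2) $A$ is a limit of a sequence $(A_m)_{m=1}^\infty$ of half-normal matrices in $\mathcal{M}_n(\mathbb{C})$, each of which has pairwise distinct singular values. (3) $A$ has a polar decomposition $A=PU$ into a product of a positive $P$ and a unitary $U$ such that for every $k\in\mathbb{N}$ the matrix $(U^* )^kPU^k$ commutes with $P$.
   Context: $\mathcal{M}_n(\mathbb{C})$ is the algebra of $n\times n$ complex matrices. A matrix $A$ is half-normal if $A^*A$ and $AA^*$ commute. A weighted permutation is a matrix with at most one nonzero entry in every row and every column (equivalently, a matrix $DV$ with $D$ diagonal and $V$ a permutation matrix). $A$ is unitarily equivalent to $B$ if $B=W^*AW$ for some unitary $W$. "Positive" means positive semidefinite. The singular values of $T$ are the eigenvalues of $(T^*T)^{1/2}$; "pairwise distinct" means that all $n$ of them, counted with multiplicity, are distinct. $A$ is not assumed invertible, so the polar decomposition $A=PU$ ($P$ positive, $U$ unitary) need not be unique. *)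

theory Defs
  imports "HOL-Analysis.Analysis" "HOL-Computational_Algebra.Polynomial"
begin

definition conj_transpose :: "complex^'n^'m \<Rightarrow> complex^'m^'n" where
  "conj_transpose A = (\<chi> i j. cnj (A $ j $ i))"

definition unitary :: "complex^'n^'n \<Rightarrow> bool" where
  "unitary U \<longleftrightarrow> conj_transpose U ** U = mat 1 \<and> U ** conj_transpose U = mat 1"

(* The sum is the inner product of P x with x, linear in the first argument;
   it is real because P is Hermitian. *)
definition positive_semidefinite :: "complex^'n^'n \<Rightarrow> bool" where
  "positive_semidefinite P \<longleftrightarrow>
     conj_transpose P = P \<and> (\<forall>x. 0 \<le> Re (\<Sum>i\<in>UNIV. (P *v x) $ i * cnj (x $ i)))"

definition commutes :: "complex^'n^'n \<Rightarrow> complex^'n^'n \<Rightarrow> bool" where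
  "commutes A B \<longleftrightarrow> A ** B = B ** A"

definition half_normal :: "complex^'n^'n \<Rightarrow> bool" where
  "half_normal A \<longleftrightarrow> commutes (conj_transpose A ** A) (A ** conj_transpose A)"

definition weighted_permutation :: "complex^'n^'n \<Rightarrow> bool" where
  "weighted_permutation B \<longleftrightarrow>
     (\<forall>i. card {j. B $ i $ j \<noteq> 0} \<le> 1) \<and> (\<forall>j. card {i. B $ i $ j \<noteq> 0} \<le> 1)"

definition unitarily_equivalent :: "complex^'n^'n \<Rightarrow> complex^'n^'n \<Rightarrow> bool" where
  "unitarily_equivalent A B \<longleftrightarrow> (\<exists>W. unitary W \<and> B = conj_transpose W ** A ** W)"

(* Meaningful only for positive semidefinite M, where the square root exists and is unique. *)
definition psd_sqrt :: "complex^'n^'n \<Rightarrow> complex^'n^'n" where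
  "psd_sqrt M = (THE P. positive_semidefinite P \<and> P ** P = M)"

definition charpoly :: "complex^'n^'n \<Rightarrow> complex poly" where
  "charpoly A = det (\<chi> i j. (if i = j then [:0, 1:] else 0) - [:A $ i $ j:])"

(* Eigenvalues and singular values are counted with (algebraic) multiplicity,
   so both multisets have exactly CARD('n) elements. *)
definition eigenvalues :: "complex^'n^'n \<Rightarrow> complex multiset" where
  "eigenvalues A = proots (charpoly A)"

definition singular_values :: "complex^'n^'n \<Rightarrow> complex multiset" where
  "singular_values T = eigenvalues (psd_sqrt (conj_transpose T ** T))"

definition distinct_singular_values :: "complex^'n^'n \<Rightarrow> bool" where
  "distinct_singular_values T \<longleftrightarrow> (\<forall>s. count (singular_values T) s \<le> 1)"

(* The library's power operator on matrices is entrywise, hence this definition. *)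
definition matrix_power :: "complex^'n^'n \<Rightarrow> nat \<Rightarrow> complex^'n^'n" where
  "matrix_power A k = ((**) A ^^ k) (mat 1)"

end

theory Submission
  imports Defs "HOL-Computational_Algebra.Fundamental_Theorem_Algebra"
begin

text \<open>
  If \<open>T\<close> is half-normal with distinct singular values, conjugate it so that \<open>T\<^sup>* T\<close> is diagonal with
  distinct entries; then \<open>T T\<^sup>*\<close>, commuting with it, is diagonal as well, and comparing entries in
  \<open>(T T\<^sup>*) T = T (T\<^sup>* T)\<close> shows that \<open>T\<close> is a weighted permutation. Weighted permutations visibly
  satisfy (3), and (3) survives limits because the unitary group is compact; this gives (2) to (3).
  Conversely, perturbing the moduli of the weights of a weighted permutation makes its singular
  values distinct, so (1) implies (2).

  For (3) to (1), the matrices \<open>Q\<^sub>k = (U\<^sup>*)\<^sup>k P U\<^sup>k\<close> commute with each other, and \<open>Q\<^sub>k U = U Q\<^sub>k\<^sub>+\<^sub>1\<close>, so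
  \<open>U\<close> maps a joint eigenvector with character \<open>k \<mapsto> \<mu> k\<close> to one with the shifted character
  \<open>k \<mapsto> \<mu> (k + 1)\<close>. Let \<open>r > 0\<close> be the least number such that some joint eigenvector \<open>w\<close> is also an
  eigenvector of \<open>U\<^sup>r\<close>. By minimality the vectors \<open>w, U w, \<dots>, U\<^sup>r\<^sup>-\<^sup>1 w\<close> have distinct characters and
  hence are orthogonal. They span a reducing subspace on which \<open>P\<close> is diagonal and \<open>U\<close> is a weighted
  cycle, and one continues in the orthogonal complement.
\<close>

subsection \<open>The complex inner product\<close>

definition cinner :: "complex^'n \<Rightarrow> complex^'n \<Rightarrow> complex" where
  "cinner x y = (\<Sum>i\<in>UNIV. x $ i * cnj (y $ i))"

lemma cinner_simps [simp]:
  "cinner 0 y = 0" "cinner x 0 = 0"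
  "cinner (x + x') y = cinner x y + cinner x' y"
  "cinner x (y + y') = cinner x y + cinner x y'"
  "cinner (x - x') y = cinner x y - cinner x' y"
  "cinner x (y - y') = cinner x y - cinner x y'"
  "cinner (c *s x) y = c * cinner x y"
  "cinner x (c *s y) = cnj c * cinner x y"
  by (simp_all add: cinner_def sum.distrib sum_subtractf algebra_simps sum_distrib_left)

lemma cinner_sum_left: "cinner (\<Sum>a\<in>S. f a) y = (\<Sum>a\<in>S. cinner (f a) y)"
  by (induction S rule: infinite_finite_induct) auto

lemma cnj_cinner: "cnj (cinner x y) = cinner y x"
  by (simp add: cinner_def mult.commute)

lemma cinner_self: "cinner x x = complex_of_real (\<Sum>i\<in>UNIV. (cmod (x $ i))\<^sup>2)"
  by (simp only: cinner_def complex_norm_square of_real_sum)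

lemma cinner_self_eq_0 [simp]: "cinner x x = 0 \<longleftrightarrow> x = 0"
  unfolding cinner_self of_real_eq_0_iff
  by (subst sum_nonneg_eq_0_iff) (auto simp: vec_eq_iff)

lemma Re_cinner_self_nonneg: "0 \<le> Re (cinner x x)"
  by (simp add: cinner_self sum_nonneg)

lemma cinner_conj_transpose: "cinner (A *v x) y = cinner x (conj_transpose A *v y)"
proof -
  have "cinner (A *v x) y = (\<Sum>i\<in>UNIV. \<Sum>j\<in>UNIV. A $ i $ j * x $ j * cnj (y $ i))"
    by (simp add: cinner_def matrix_vector_mult_def sum_distrib_right)
  also have "\<dots> = (\<Sum>j\<in>UNIV. \<Sum>i\<in>UNIV. A $ i $ j * x $ j * cnj (y $ i))"
    by (rule sum.swap)
  also have "\<dots> = cinner x (conj_transpose A *v y)"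
    by (simp add: cinner_def matrix_vector_mult_def conj_transpose_def sum_distrib_left mult_ac)
  finally show ?thesis .
qed

section \<open>Adjoints and unitary matrices\<close>

lemma conj_transpose_conj_transpose [simp]: "conj_transpose (conj_transpose A) = A"
  by (simp add: conj_transpose_def vec_eq_iff)

lemma conj_transpose_mult: "conj_transpose (A ** B) = conj_transpose B ** conj_transpose A"
  by (simp add: conj_transpose_def matrix_matrix_mult_def vec_eq_iff mult.commute)

lemma conj_transpose_mat_1 [simp]: "conj_transpose (mat 1) = mat 1"
  by (simp add: conj_transpose_def mat_def vec_eq_iff)

lemma unitary_conj_transpose: "unitary U \<Longrightarrow> unitary (conj_transpose U)"
  by (simp add: unitary_def)

lemma unitaryD:
  assumes "unitary U"
  shows "conj_transpose U ** U = mat 1" "U ** conj_transpose U = mat 1"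
    "conj_transpose U ** (U ** A) = A" "U ** (conj_transpose U ** A) = A"
  using assms by (simp_all add: unitary_def matrix_mul_assoc)

lemma unitary_vecD:
  assumes "unitary U"
  shows "conj_transpose U *v (U *v x) = x" "U *v (conj_transpose U *v x) = x"
  using assms by (simp_all add: unitary_def matrix_vector_mul_assoc)

lemma unitary_mult: "unitary U \<Longrightarrow> unitary V \<Longrightarrow> unitary (U ** V)"
  unfolding unitary_def[of "U ** V"]
  by (simp add: conj_transpose_mult matrix_mul_assoc[symmetric] unitaryD)

lemma unitary_mat_1 [simp]: "unitary (mat 1)"
  by (simp add: unitary_def)

lemma unitary_eq_0_iff: "unitary U \<Longrightarrow> U *v x = 0 \<longleftrightarrow> x = 0"
  by (metis unitary_vecD(1) matrix_vector_mult_0_right)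

lemma cinner_unitary: "unitary U \<Longrightarrow> cinner (U *v x) (U *v y) = cinner x y"
  by (simp add: cinner_conj_transpose unitary_vecD)

lemma hermitian_cinner: "conj_transpose P = P \<Longrightarrow> cinner (P *v x) y = cinner x (P *v y)"
  by (simp add: cinner_conj_transpose)

text \<open>Moving \<open>P\<close> across the inner product, first for the pair \<open>y\<close>,
  \<open>y\<close>, shows that \<open>b\<close> is real, and then for \<open>x\<close>,
  \<open>y\<close> that \<open>a - b\<close> annihilates \<open>cinner x y\<close>.\<close>

lemma hermitian_eigenvectors_orthogonal:
  assumes H: "conj_transpose P = P"
    and x: "P *v x = a *s x" and y: "P *v y = b *s y" and "a \<noteq> b"
  shows "cinner x y = 0"
proof (cases "y = 0")
  case False
  have "b * cinner y y = cnj b * cinner y y"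
    using hermitian_cinner[OF H, of y y] by (simp add: y)
  then have "cnj b = b" using False by simp
  moreover have "a * cinner x y = cnj b * cinner x y"
    using hermitian_cinner[OF H, of x y] by (simp add: x y)
  ultimately show ?thesis using \<open>a \<noteq> b\<close> by simp
qed simp

subsection \<open>Common eigenvectors\<close>

text \<open>This is the vector p(T) v, evaluated by Horner's rule; with \<open>v\<close> fixed, the
  matrix p(T) is never formed.\<close>

definition poly_matrix_vec :: "complex^'n^'n \<Rightarrow> complex^'n \<Rightarrow> complex poly \<Rightarrow> complex^'n" where
  "poly_matrix_vec T v p = fold_coeffs (\<lambda>a w. a *s v + T *v w) p 0"

lemma poly_matrix_vec_0 [simp]: "poly_matrix_vec T v 0 = 0"
  by (simp add: poly_matrix_vec_def)

lemma poly_matrix_vec_pCons [simp]: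
  "poly_matrix_vec T v (pCons a p) = a *s v + T *v poly_matrix_vec T v p"
  by (cases "p = 0 \<and> a = 0") (auto simp: poly_matrix_vec_def)

lemma poly_matrix_vec_add:
  "poly_matrix_vec T v (p + q) = poly_matrix_vec T v p + poly_matrix_vec T v q"
  by (induction p q rule: poly_induct2)
     (simp_all add: vec.scale_left_distrib matrix_vector_right_distrib)

lemma poly_matrix_vec_sum:
  "poly_matrix_vec T v (\<Sum>i\<in>S. f i) = (\<Sum>i\<in>S. poly_matrix_vec T v (f i))"
  by (induction S rule: infinite_finite_induct) (simp_all add: poly_matrix_vec_add)

lemma poly_matrix_vec_monom:
  "poly_matrix_vec T v (monom c i) = c *s (((*v) T ^^ i) v)"
  by (induction i) (simp_all add: monom_0 monom_Suc vector_scalar_commute)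

text \<open>The factor T - z commutes with q(T), so it may be applied to \<open>v\<close>
  first.\<close>

lemma poly_matrix_vec_linear_factor:
  "poly_matrix_vec T v ([:-z, 1:] * q) = poly_matrix_vec T (T *v v - z *s v) q"
proof (induction q)
  case (pCons a q)
  have "poly_matrix_vec T v ([:-z, 1:] * pCons a q)
      = poly_matrix_vec T v ([:-z * a, a:] + pCons 0 ([:-z, 1:] * q))"
    by (simp add: algebra_simps)
  also have "\<dots> = poly_matrix_vec T (T *v v - z *s v) (pCons a q)"
    using pCons.IH unfolding poly_matrix_vec_add
    by (simp add: vector_scalar_commute matrix_vector_mult_diff_distrib vector_smult_assoc
        vec.scale_right_diff_distrib mult.commute)
  finally show ?case .
qed simp

text \<open>The n + 1 vectors v, T v, ..., T^n v lie in a space of dimension n, and a linear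
  relation between them is the required polynomial.\<close>

lemma annihilating_poly_exists:
  fixes T :: "complex^'n^'n"
  obtains p where "p \<noteq> 0" "poly_matrix_vec T v p = 0"
proof -
  let ?f = "\<lambda>i. ((*v) T ^^ i) v" and ?I = "{..CARD('n)}"
  have nz: "p \<noteq> 0" if "coeff p i \<noteq> 0" for p :: "complex poly" and i
    using that by auto
  have "\<exists>p. p \<noteq> 0 \<and> poly_matrix_vec T v p = 0"
  \<comment> \<open>Linear dependence of a set does not see repetitions, so a coincidence T^i v =
    T^j v is treated separately, with the polynomial x^i - x^j.\<close>
  proof (cases "inj_on ?f ?I")
    case False
    then obtain i j where "i \<noteq> j" "?f i = ?f j" unfolding inj_on_def by blast
    then have "poly_matrix_vec T v (monom 1 i + monom (-1) j) = 0"
      by (simp add: poly_matrix_vec_add poly_matrix_vec_monom)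
    moreover have "coeff (monom 1 i + monom (-1) j :: complex poly) i \<noteq> 0"
      using \<open>i \<noteq> j\<close> by simp
    ultimately show ?thesis using nz by blast
  next
    case True
    have "vec.dependent (?f ` ?I)"
    proof (rule ccontr)
      assume "\<not> vec.dependent (?f ` ?I)"
      then have "card (?f ` ?I) \<le> vec.dim (UNIV :: (complex^'n) set)"
        by (intro vec.independent_card_le_dim) auto
      with card_image[OF True] show False by (simp del: vec.dim_UNIV add: vec_dim_card)
    qed
    then obtain u where u: "\<exists>x\<in>?f ` ?I. u x \<noteq> 0" "(\<Sum>x\<in>?f ` ?I. u x *s x) = 0"
      by (auto simp: vec.dependent_finite)
    let ?p = "\<Sum>i\<in>?I. monom (u (?f i)) i"
    have "poly_matrix_vec T v ?p = 0"
      using u(2) sum.reindex[OF True, of "\<lambda>x. u x *s x"]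
      by (simp add: poly_matrix_vec_sum poly_matrix_vec_monom)
    moreover obtain i where "i \<in> ?I" "u (?f i) \<noteq> 0" using u(1) by blast
    then have "coeff ?p i \<noteq> 0" by (simp add: coeff_sum)
    ultimately show ?thesis using nz by blast
  qed
  with that show thesis by blast
qed

text \<open>Split a root z off an annihilating polynomial of \<open>v\<close>. Either T v = z v, or
  (T - z) v is a nonzero vector of \<open>M\<close> annihilated by the quotient, whose degree is
  smaller. A nonzero constant annihilates only the zero vector, which settles degree 0.\<close>

lemma invariant_subspace_eigenvector:
  fixes T :: "complex^'n^'n"
  assumes M: "vec.subspace M" and inv: "\<And>x. x \<in> M \<Longrightarrow> T *v x \<in> M" and v: "v \<in> M" "v \<noteq> 0"
  obtains w c where "w \<in> M" "w \<noteq> 0" "T *v w = c *s w"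
proof -
  have "p \<noteq> 0 \<Longrightarrow> poly_matrix_vec T v p = 0 \<Longrightarrow> v \<in> M \<Longrightarrow> v \<noteq> 0 \<Longrightarrow>
      \<exists>w\<in>M. w \<noteq> 0 \<and> (\<exists>c. T *v w = c *s w)" for p v
  proof (induction "degree p" arbitrary: p v)
    case 0
    then obtain a where "p = [:a:]" by (metis degree_eq_zeroE)
    with 0 show ?case by simp
  next
    case (Suc d)
    then have "\<not> constant (poly p)" by (simp add: constant_degree)
    then obtain z where "poly p z = 0" using fundamental_theorem_of_algebra by blast
    then obtain q where p: "p = [:-z, 1:] * q" by (auto simp: poly_eq_0_iff_dvd)
    let ?v = "T *v v - z *s v"
    have "q \<noteq> 0" using p Suc.prems by auto
    then have "degree q = d" using Suc.hyps(2) by (simp add: p degree_mult_eq del: mult_pCons_left)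
    have "?v \<in> M" using M inv Suc.prems(3) by (simp add: vec.subspace_diff vec.subspace_scale)
    show ?case
    proof (cases "?v = 0")
      case True
      with Suc.prems show ?thesis by auto
    next
      case False
      have "poly_matrix_vec T ?v q = 0"
        using Suc.prems(2) by (simp only: p poly_matrix_vec_linear_factor)
      then show ?thesis
        using Suc.hyps(1)[of q ?v] \<open>q \<noteq> 0\<close> \<open>degree q = d\<close> \<open>?v \<in> M\<close> False by blast
    qed
  qed
  moreover obtain p where "p \<noteq> 0" "poly_matrix_vec T v p = 0"
    by (rule annihilating_poly_exists)
  ultimately show thesis using v that by blast
qed

text \<open>Every member of \<open>F\<close> acts as a scalar on a nonzero invariant subspace of
  minimal dimension: its eigenspace there is again invariant, by commutation, and so is the whole
  subspace. The argument also covers infinite families, such as that of all twists below.\<close>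

lemma commuting_common_eigenvector:
  fixes F :: "(complex^'n^'n) set"
  assumes comm: "\<And>S T. S \<in> F \<Longrightarrow> T \<in> F \<Longrightarrow> commutes S T"
    and M: "vec.subspace M" and inv: "\<And>T x. T \<in> F \<Longrightarrow> x \<in> M \<Longrightarrow> T *v x \<in> M"
    and v: "v \<in> M" "v \<noteq> 0"
  obtains w where "w \<in> M" "w \<noteq> 0" "\<And>T. T \<in> F \<Longrightarrow> \<exists>c. T *v w = c *s w"
proof -
  define good where "good N \<longleftrightarrow> vec.subspace N \<and> N \<subseteq> M \<and> (\<forall>T\<in>F. \<forall>x\<in>N. T *v x \<in> N) \<and> (\<exists>x\<in>N. x \<noteq> 0)"
    for N :: "(complex^'n) set"
  have "good M" using assms by (auto simp: good_def)
  then obtain N where N: "good N" and least: "\<And>N'. good N' \<Longrightarrow> vec.dim N \<le> vec.dim N'"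
    using arg_min_natI[of good M vec.dim] arg_min_nat_le[of good _ vec.dim] by blast
  then obtain x where x: "x \<in> N" "x \<noteq> 0" and N': "vec.subspace N" "N \<subseteq> M"
      and invN: "\<And>T x. T \<in> F \<Longrightarrow> x \<in> N \<Longrightarrow> T *v x \<in> N"
    by (auto simp: good_def)
  have "\<exists>c. T *v x = c *s x" if T: "T \<in> F" for T
  proof -
    obtain w c where w: "w \<in> N" "w \<noteq> 0" "T *v w = c *s w"
      using invariant_subspace_eigenvector[of N T x] invN[OF T] N' x by blast
    let ?E = "{y \<in> N. T *v y = c *s y}"
    have "S *v y \<in> ?E" if "S \<in> F" "y \<in> ?E" for S y
    proof -
      have "T *v (S *v y) = S *v (T *v y)"
        using comm[OF \<open>T \<in> F\<close> \<open>S \<in> F\<close>] by (simp add: matrix_vector_mul_assoc commutes_def)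
      with that invN show ?thesis by (simp add: vector_scalar_commute)
    qed
    moreover have E: "vec.subspace ?E"
      using \<open>vec.subspace N\<close>
      by (auto simp: vec.subspace_def matrix_vector_right_distrib vector_add_ldistrib
          vector_scalar_commute vector_smult_assoc mult.commute)
    ultimately have "good ?E" using N' w by (auto simp: good_def)
    then have "?E = N"
      using E N' least by (intro vec.subspace_dim_equal) auto
    with x show ?thesis by auto
  qed
  with x \<open>N \<subseteq> M\<close> that show thesis by blast
qed

subsection \<open>Orthonormal sets\<close>

definition orthonormal :: "(complex^'n) set \<Rightarrow> bool" where
  "orthonormal B \<longleftrightarrow> (\<forall>x\<in>B. \<forall>y\<in>B. cinner x y = of_bool (x = y))"

lemma orthonormal_independent:
  assumes "orthonormal B"
  shows "vec.independent B"
proof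
  assume "vec.dependent B"
  then obtain S u x where S: "finite S" "S \<subseteq> B" "(\<Sum>b\<in>S. u b *s b) = 0" "x \<in> S" "u x \<noteq> 0"
    unfolding vec.dependent_explicit by blast
  have "cinner b x = of_bool (b = x)" if "b \<in> S" for b
    using assms S(2,4) that unfolding orthonormal_def by blast
  then have "cinner (\<Sum>b\<in>S. u b *s b) x = (\<Sum>b\<in>S. u b * of_bool (b = x))"
    by (simp add: cinner_sum_left)
  also have "\<dots> = u x"
    using S(1,4) by (simp add: of_bool_def if_distrib sum.delta cong: if_cong)
  finally show False using S(3,5) by simp
qed

lemma
  fixes B :: "(complex^'n) set"
  assumes "orthonormal B"
  shows orthonormal_finite: "finite B" and orthonormal_card: "card B \<le> CARD('n)"
proof -
  note ind = orthonormal_independent[OF assms]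
  show "finite B" by (rule vec.finiteI_independent[OF ind])
  show "card B \<le> CARD('n)"
    using vec.independent_card_le_dim[OF subset_UNIV ind] by (metis vec_dim_card)
qed

text \<open>Take a vector outside the span of \<open>B\<close> and subtract its orthogonal
  projection onto that span.\<close>

lemma orthonormal_orthogonal_vector:
  fixes B :: "(complex^'n) set"
  assumes B: "orthonormal B" and card: "card B < CARD('n)"
  obtains x where "x \<noteq> 0" "\<And>b. b \<in> B \<Longrightarrow> cinner x b = 0"
proof -
  have fin: "finite B" by (rule orthonormal_finite[OF B])
  have "vec.span B \<noteq> UNIV"
  proof
    assume *: "vec.span B = UNIV"
    have "vec.dim (UNIV :: (complex^'n) set) \<le> card B"
      by (rule vec.dim_le_card) (use * fin in auto)
    then show False using card by (simp only: vec_dim_card)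
  qed
  then obtain y where y: "y \<notin> vec.span B" by blast
  let ?s = "\<Sum>b\<in>B. cinner y b *s b"
  have "?s \<in> vec.span B" by (intro vec.span_sum vec.span_scale vec.span_base)
  then have "y - ?s \<noteq> 0" using y by auto
  moreover have "cinner (y - ?s) b = 0" if "b \<in> B" for b
  proof -
    have "cinner ?s b = (\<Sum>a\<in>B. cinner y a * of_bool (a = b))"
      using B that by (auto simp: cinner_sum_left orthonormal_def intro!: sum.cong)
    also have "\<dots> = cinner y b"
      using fin that by (simp add: of_bool_def if_distrib sum.delta cong: if_cong)
    finally show ?thesis by simp
  qed
  ultimately show thesis using that by blast
qed

text \<open>An orthonormal set with property \<open>R\<close> of greatest cardinality must be a
  basis, since otherwise \<open>step\<close> enlarges it. The step may add several vectors at once;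
  this is how a whole cycle of a unitary is adjoined later.\<close>

lemma orthonormal_basis_by_extension:
  fixes R :: "(complex^'n) set \<Rightarrow> bool"
  assumes base: "R {}"
    and step: "\<And>B x. orthonormal B \<Longrightarrow> R B \<Longrightarrow> x \<noteq> 0 \<Longrightarrow> (\<And>b. b \<in> B \<Longrightarrow> cinner x b = 0) \<Longrightarrow>
      \<exists>B'. B \<subset> B' \<and> orthonormal B' \<and> R B'"
  obtains B where "orthonormal B" "R B" "card B = CARD('n)"
proof -
  have "\<exists>B. (orthonormal B \<and> R B) \<and> (\<forall>B'. orthonormal B' \<and> R B' \<longrightarrow> card B' \<le> card B)"
  proof (rule ex_has_greatest_nat[of "\<lambda>B. orthonormal B \<and> R B" "{}" card "Suc CARD('n)"])
    show "orthonormal {} \<and> R {}" using base by (simp add: orthonormal_def)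
    show "\<forall>B'. orthonormal B' \<and> R B' \<longrightarrow> card B' < Suc CARD('n)"
      using orthonormal_card by (auto simp: less_Suc_eq_le)
  qed
  then obtain B where B: "orthonormal B" "R B"
      and max: "\<And>B'. orthonormal B' \<Longrightarrow> R B' \<Longrightarrow> card B' \<le> card B"
    by blast
  have "\<not> card B < CARD('n)"
  proof
    assume "card B < CARD('n)"
    then obtain x where "x \<noteq> 0" "\<And>b. b \<in> B \<Longrightarrow> cinner x b = 0"
      using orthonormal_orthogonal_vector[OF B(1)] by blast
    then obtain B' where B': "B \<subset> B'" "orthonormal B'" "R B'" using step[OF B] by blast
    then have "card B < card B'" by (intro psubset_card_mono orthonormal_finite)
    with max[OF B'(2,3)] show False by simp
  qed
  with orthonormal_card[OF B(1)] that B show thesis by force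
qed

section \<open>Normalisation, and unitary matrices from orthonormal bases\<close>

definition unit_vec :: "complex^'n \<Rightarrow> complex^'n" where
  "unit_vec x = complex_of_real (1 / sqrt (Re (cinner x x))) *s x"

lemma cinner_self_of_real: "cinner x x = complex_of_real (Re (cinner x x))"
  by (simp add: cinner_self)

lemma Re_cinner_self_pos: "x \<noteq> 0 \<Longrightarrow> 0 < Re (cinner x x)"
  by (metis cinner_self_eq_0 cinner_self_of_real Re_cinner_self_nonneg less_le of_real_0)

lemma cinner_unit_vec:
  assumes "x \<noteq> 0"
  shows "cinner (unit_vec x) (unit_vec x) = 1"
proof -
  define s where "s = Re (cinner x x)"
  have s: "0 < s" "cinner x x = complex_of_real s"
    unfolding s_def by (rule Re_cinner_self_pos[OF assms], rule cinner_self_of_real)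
  have "cinner (unit_vec x) (unit_vec x) = complex_of_real (1 / sqrt s * (1 / sqrt s) * s)"
    by (simp add: unit_vec_def s(2) flip: of_real_mult of_real_divide)
  then show ?thesis using s(1) by simp
qed

lemma unit_vec_scale_back: "x \<noteq> 0 \<Longrightarrow> \<exists>a. x = a *s unit_vec x"
  using Re_cinner_self_pos[of x]
  by (intro exI[of _ "complex_of_real (sqrt (Re (cinner x x)))"]) (simp add: unit_vec_def)

lemma orthogonal_family_unit_vec:
  assumes "\<And>i. i \<in> I \<Longrightarrow> x i \<noteq> 0"
    and "\<And>i j. i \<in> I \<Longrightarrow> j \<in> I \<Longrightarrow> i \<noteq> j \<Longrightarrow> cinner (x i) (x j) = 0"
  shows "orthonormal ((\<lambda>i. unit_vec (x i)) ` I)" "inj_on (\<lambda>i. unit_vec (x i)) I"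
proof -
  have *: "cinner (unit_vec (x i)) (unit_vec (x j)) = of_bool (i = j)" if "i \<in> I" "j \<in> I" for i j
    using assms that by (cases "i = j") (auto simp: cinner_unit_vec, simp add: unit_vec_def)
  show inj: "inj_on (\<lambda>i. unit_vec (x i)) I"
  proof (rule inj_onI)
    fix i j assume "i \<in> I" "j \<in> I" "unit_vec (x i) = unit_vec (x j)"
    then show "i = j" using *[of i j] *[of j j] by (cases "i = j") auto
  qed
  show "orthonormal ((\<lambda>i. unit_vec (x i)) ` I)"
    using * inj by (auto simp: orthonormal_def dest: inj_onD)
qed

text \<open>The columns of \<open>W\<close> are the basis vectors, indexed by a bijection
  \<open>w\<close>. The last conclusion describes the matrix of \<open>A\<close> in this basis; its
  instance for the identity matrix is the unitarity of \<open>W\<close>.\<close>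

lemma orthonormal_basis_unitary:
  fixes B :: "(complex^'n) set"
  assumes B: "orthonormal B" and card: "card B = CARD('n)"
  obtains W :: "complex^'n^'n" and w where "unitary W" "bij_betw w UNIV B"
    "\<And>i j. cinner (w j) (w i) = of_bool (i = j)"
    "\<And>A i j. (conj_transpose W ** A ** W) $ i $ j = cinner (A *v w j) (w i)"
proof -
  obtain w :: "'n \<Rightarrow> complex^'n" where w: "bij_betw w UNIV B"
    using finite_same_card_bij[of "UNIV :: 'n set" B] card orthonormal_finite[OF B] by auto
  define W :: "complex^'n^'n" where "W = (\<chi> i j. w j $ i)"
  have entry: "(conj_transpose W ** A ** W) $ i $ j = cinner (A *v w j) (w i)" for A i j
    unfolding matrix_mul_assoc[symmetric]
    by (simp add: W_def conj_transpose_def matrix_matrix_mult_def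
        matrix_vector_mult_def cinner_def mult.commute)
  have on: "cinner (w j) (w i) = of_bool (i = j)" for i j
    using B w by (auto simp: orthonormal_def bij_betw_def inj_eq)
  then have "conj_transpose W ** mat 1 ** W = mat 1"
    unfolding vec_eq_iff entry matrix_vector_mul_lid by (simp add: mat_def)
  then have "unitary W" using matrix_left_right_inverse[of "conj_transpose W" W]
    by (simp add: unitary_def)
  with w on entry that show thesis by blast
qed

subsection \<open>A basis adapted to a Hermitian matrix and a unitary\<close>

text \<open>These are the matrices \<open>Q\<^sub>k\<close> of the overview, the left-hand sides of
  the commutation condition in (3).\<close>

definition twist :: "complex^'n^'n \<Rightarrow> complex^'n^'n \<Rightarrow> nat \<Rightarrow> complex^'n^'n" where
  "twist U P k = matrix_power (conj_transpose U) k ** P ** matrix_power U k"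

lemma matrix_power_0 [simp]: "matrix_power A 0 = mat 1"
  by (simp add: matrix_power_def)

lemma matrix_power_Suc: "matrix_power A (Suc k) = A ** matrix_power A k"
  by (simp add: matrix_power_def)

lemma matrix_power_Suc2: "matrix_power A (Suc k) = matrix_power A k ** A"
  by (induction k) (simp add: matrix_power_Suc, metis matrix_mul_assoc matrix_power_Suc)

lemma conj_transpose_matrix_power:
  "conj_transpose (matrix_power A k) = matrix_power (conj_transpose A) k"
  by (induction k) (simp, metis conj_transpose_mult matrix_power_Suc matrix_power_Suc2)

lemma twist_0 [simp]: "twist U P 0 = P"
  by (simp add: twist_def)

lemma twist_Suc: "twist U P (Suc k) = conj_transpose U ** twist U P k ** U"
  unfolding twist_def matrix_power_Suc[of "conj_transpose U"] matrix_power_Suc2[of U]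
  by (simp add: matrix_mul_assoc)

lemma twist_hermitian:
  "conj_transpose P = P \<Longrightarrow> conj_transpose (twist U P k) = twist U P k"
  by (simp add: twist_def conj_transpose_mult conj_transpose_matrix_power matrix_mul_assoc)

text \<open>Conjugation by \<open>U\<close> raises both indices by one, so the commutation of
  \<open>P\<close> with the twist of index d propagates to the indices i and i + d.\<close>

lemma twist_commutes:
  assumes U: "unitary U" and comm: "\<And>k. commutes (twist U P k) P"
  shows "commutes (twist U P i) (twist U P j)"
proof -
  have *: "twist U P i ** twist U P (i + d) = twist U P (i + d) ** twist U P i" for i d
  proof (induction i)
    case 0
    then show ?case using comm[of d] by (simp add: commutes_def)
  next
    case (Suc i)
    have mult: "twist U P (Suc a) ** twist U P (Suc b) = conj_transpose U ** (twist U P a ** twist U P b) ** U" for a b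
      using U by (simp add: twist_Suc matrix_mul_assoc[symmetric] unitaryD)
    show ?case using Suc by (simp add: mult)
  qed
  show ?thesis
    using *[of i "j - i"] *[of j "i - j"] by (cases "i \<le> j") (auto simp: commutes_def)
qed


text \<open>The set \<open>C\<close> is a single cycle of \<open>U\<close> consisting of joint
  eigenvectors of all twists. It is closed up to scalars under both \<open>U\<close> and its
  adjoint, which makes its orthogonal complement invariant under both.\<close>

lemma adapted_orthonormal_set:
  fixes P U :: "complex^'n^'n"
  assumes P: "conj_transpose P = P" and U: "unitary U"
    and comm: "\<And>k. commutes (twist U P k) P"
    and M: "vec.subspace M" and inv: "\<And>x. x \<in> M \<Longrightarrow> P *v x \<in> M" "\<And>x. x \<in> M \<Longrightarrow> U *v x \<in> M"
      "\<And>x. x \<in> M \<Longrightarrow> conj_transpose U *v x \<in> M"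
    and v0: "v0 \<in> M" "v0 \<noteq> 0"
  obtains C where "C \<noteq> {}" "C \<subseteq> M" "orthonormal C" "\<And>b. b \<in> C \<Longrightarrow> \<exists>c. P *v b = c *s b"
    "\<And>b. b \<in> C \<Longrightarrow> \<exists>b'\<in>C. \<exists>c. U *v b = c *s b'"
    "\<And>b. b \<in> C \<Longrightarrow> \<exists>b'\<in>C. \<exists>c. conj_transpose U *v b = c *s b'"
proof -
  define Q where "Q = twist U P"
  define pow where "pow i x = matrix_power U i *v x" for i x
  \<comment> \<open>Here \<mu> is the character of the joint eigenvector \<open>v\<close>, and
    \<open>shift i \<mu>\<close> will be that of U^i v.\<close>
  define eig where "eig v \<mu> \<longleftrightarrow> v \<in> M \<and> v \<noteq> 0 \<and> (\<forall>k. Q k *v v = \<mu> k *s v)"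
    for v and \<mu> :: "nat \<Rightarrow> complex"
  define shift where "shift i \<mu> k = \<mu> (k + i)" for i k :: nat and \<mu> :: "nat \<Rightarrow> complex"
  have pow_0 [simp]: "pow 0 x = x" for x by (simp add: pow_def)
  have pow_Suc: "pow (Suc i) x = U *v pow i x" for i x
    by (simp add: pow_def matrix_power_Suc matrix_vector_mul_assoc)
  have powM: "pow i x \<in> M" if "x \<in> M" for i x
    using that by (induction i) (auto simp: pow_Suc inv)
  have pow_nz: "pow i x \<noteq> 0" if "x \<noteq> 0" for i x
    using that by (induction i) (auto simp: pow_Suc unitary_eq_0_iff[OF U])
  have pow_scale: "pow i (c *s x) = c *s pow i x" for i c x
    by (simp add: pow_def vector_scalar_commute)
  have QU: "Q k *v (U *v x) = U *v (Q (Suc k) *v x)" for k x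
    using U by (simp add: Q_def twist_Suc matrix_vector_mul_assoc matrix_mul_assoc unitaryD)
  have QM: "Q k *v x \<in> M" if "x \<in> M" for k x
    using that
  proof (induction k arbitrary: x)
    case (Suc k)
    then show ?case
      by (simp add: Q_def twist_Suc inv flip: matrix_vector_mul_assoc)
  qed (simp add: Q_def inv)
  have eig_pow: "eig (pow i v) (shift i \<mu>)" if "eig v \<mu>" for i v \<mu>
  proof -
    have "Q k *v pow i v = \<mu> (k + i) *s pow i v" for k
      by (induction i arbitrary: k)
         (use that in \<open>simp_all add: eig_def pow_Suc QU vector_scalar_commute\<close>)
    then show ?thesis using that by (simp add: eig_def shift_def powM pow_nz)
  qed
  \<comment> \<open>Two distinct characters differ at some k, and there the Hermitian matrix
    \<open>Q k\<close> separates the two vectors.\<close>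
  have eig_orth: "cinner v w = 0" if vw: "eig v \<mu>" "eig w \<psi>" and "\<mu> \<noteq> \<psi>" for v w \<mu> \<psi>
  proof -
    obtain k where "\<mu> k \<noteq> \<psi> k" using \<open>\<mu> \<noteq> \<psi>\<close> by blast
    then show ?thesis
      using hermitian_eigenvectors_orthogonal[of "Q k"] vw twist_hermitian[OF P]
      unfolding eig_def Q_def by blast
  qed
  \<comment> \<open>If the shift by \<open>r\<close> fixes the character, then \<open>U\<^sup>r\<close> maps its joint eigenspace to itself.\<close>
  have periodic: "\<exists>w z. eig w \<mu> \<and> pow r w = z *s w" if v: "eig v \<mu>" and per: "shift r \<mu> = \<mu>"
    for v \<mu> r
  proof -
    let ?E = "{x \<in> M. \<forall>k. Q k *v x = \<mu> k *s x}"
    have sub: "vec.subspace ?E"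
      using M by (auto simp: vec.subspace_def matrix_vector_right_distrib vector_add_ldistrib
          vector_scalar_commute vector_smult_assoc mult.commute)
    have "matrix_power U r *v x \<in> ?E" if "x \<in> ?E" for x
    proof (cases "x = 0")
      case False
      then have "eig (pow r x) (shift r \<mu>)" using that by (intro eig_pow) (simp add: eig_def)
      then show ?thesis by (simp add: per eig_def pow_def)
    qed (use that in simp)
    moreover have "v \<in> ?E" "v \<noteq> 0" using v by (auto simp: eig_def)
    ultimately obtain w z where "w \<in> ?E" "w \<noteq> 0" "matrix_power U r *v w = z *s w"
      using invariant_subspace_eigenvector[OF sub] by blast
    then show ?thesis by (auto simp: eig_def pow_def)
  qed
  \<comment> \<open>If all the shifted characters were distinct, the vectors U^i v would form an
    infinite orthogonal family.\<close>
  have pigeonhole: "\<exists>i j. i < j \<and> shift i \<mu> = shift j \<mu>" if v: "eig v \<mu>" for v \<mu>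
  proof (rule ccontr)
    assume "\<not> ?thesis"
    then have "shift i \<mu> \<noteq> shift j \<mu>" if "i \<noteq> j" for i j using that by (metis linorder_neqE_nat)
    then have "cinner (pow i v) (pow j v) = 0" if "i \<noteq> j" for i j
      using that eig_orth eig_pow[OF v] by blast
    then have fam: "orthonormal (range (\<lambda>i. unit_vec (pow i v)))" "inj (\<lambda>i. unit_vec (pow i v))"
      using v orthogonal_family_unit_vec[of UNIV "\<lambda>i. pow i v"] pow_nz
      by (auto simp: eig_def)
    show False
      using orthonormal_finite[OF fam(1)] finite_imageD[OF _ fam(2)] by simp
  qed
  define R where "R r \<longleftrightarrow> 0 < r \<and> (\<exists>w \<mu> z. eig w \<mu> \<and> pow r w = z *s w)" for r
  \<comment> \<open>If U^i v and U^j v have the same character, it is fixed by the shift by j - i,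
    and \<open>periodic\<close> applies to U^i v.\<close>
  have R_diff: "R (j - i)" if "eig v \<mu>" "i < j" "shift i \<mu> = shift j \<mu>" for v \<mu> i j
  proof -
    have "shift (j - i) (shift i \<mu>) = shift i \<mu>"
      using that by (simp add: shift_def fun_eq_iff add.assoc)
    from periodic[OF eig_pow[OF that(1)] this] show ?thesis using that(2) by (auto simp: R_def)
  qed
  have "\<exists>r. R r"
  proof -
    obtain v where v: "v \<in> M" "v \<noteq> 0" "\<And>T. T \<in> range Q \<Longrightarrow> \<exists>c. T *v v = c *s v"
      using commuting_common_eigenvector[of "range Q" M v0] twist_commutes[OF U comm] M v0 QM
      unfolding Q_def by blast
    then have "\<forall>k. \<exists>c. Q k *v v = c *s v" by blast
    then obtain \<mu> where "\<forall>k. Q k *v v = \<mu> k *s v" by metis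
    then have "eig v \<mu>" using v by (simp add: eig_def)
    with pigeonhole R_diff show ?thesis by blast
  qed
  define r where "r = (LEAST r. R r)"
  have "R r" unfolding r_def using \<open>\<exists>r. R r\<close> by (rule LeastI_ex)
  then obtain w \<mu> z where "0 < r" and w: "eig w \<mu>" and wz: "pow r w = z *s w"
    by (auto simp: R_def)
  have w0: "w \<in> M" "w \<noteq> 0" using w by (auto simp: eig_def)
  \<comment> \<open>Division by \<open>z\<close> will be used to step backwards from
    \<open>w\<close> to the last vector of the cycle.\<close>
  have "z \<noteq> 0" using pow_nz[OF w0(2), of r] wz by auto
  have distinct: "shift i \<mu> \<noteq> shift j \<mu>" if "i < j" "j < r" for i j
  proof
    assume "shift i \<mu> = shift j \<mu>"
    then have "R (j - i)" using R_diff[OF w] that by blast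
    then have "r \<le> j - i" unfolding r_def by (rule Least_le)
    with that show False by simp
  qed
  have orth: "cinner (pow i w) (pow j w) = 0" if "i < r" "j < r" "i \<noteq> j" for i j
    using eig_orth[OF eig_pow[OF w] eig_pow[OF w]] distinct[of i j] distinct[of j i] that
    by (metis linorder_neqE_nat)
  define f where "f i = unit_vec (pow i w)" for i
  have f: "\<exists>a. f i = a *s pow i w" for i by (auto simp: f_def unit_vec_def)
  have f': "\<exists>a. pow i w = a *s f i" for i
    unfolding f_def using pow_nz[OF w0(2)] by (rule unit_vec_scale_back)
  \<comment> \<open>Normalising changes vectors only by scalars, so relations up to a scalar pass
    from the powers of \<open>w\<close> to the unit vectors \<open>f i\<close>.\<close>
  have transfer: "\<exists>c. T *v f i = c *s f j" if Tij: "T *v pow i w = c *s pow j w" for T c i j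
  proof -
    obtain a b where "f i = a *s pow i w" "pow j w = b *s f j" using f f' by metis
    then show ?thesis using Tij by (auto simp: vector_scalar_commute vector_smult_assoc)
  qed
  have cyc: "\<exists>j<r. \<exists>c. U *v pow i w = c *s pow j w" if "i < r" for i
  proof (cases "Suc i < r")
    case True
    then show ?thesis by (intro exI[of _ "Suc i"] conjI exI[of _ 1]) (simp_all add: pow_Suc)
  next
    case False
    then have "r = Suc i" using that by simp
    then show ?thesis using wz \<open>0 < r\<close> by (intro exI[of _ 0] conjI exI[of _ z]) (simp_all add: pow_Suc)
  qed
  \<comment> \<open>The adjoint runs through the cycle backwards; from \<open>w\<close> it leads to
    U^(r-1) w, because U^r w = z w.\<close>
  have cyc': "\<exists>j<r. \<exists>c. conj_transpose U *v pow i w = c *s pow j w" if "i < r" for i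
  proof (cases i)
    case 0
    obtain m where m: "r = Suc m" using \<open>0 < r\<close> gr0_implies_Suc by blast
    have "w = inverse z *s pow r w" using \<open>z \<noteq> 0\<close> by (simp add: wz)
    also have "\<dots> = U *v (inverse z *s pow m w)" by (simp add: m pow_Suc vector_scalar_commute)
    finally have "conj_transpose U *v w = inverse z *s pow m w" by (metis unitary_vecD(1) U)
    with 0 m show ?thesis by auto
  next
    case (Suc m)
    then show ?thesis using that
      by (intro exI[of _ m] conjI exI[of _ 1]) (simp_all add: pow_Suc unitary_vecD[OF U])
  qed
  show thesis
  proof (rule that[of "f ` {..<r}"])
    show "f ` {..<r} \<noteq> {}" using \<open>0 < r\<close> by auto
    show "f ` {..<r} \<subseteq> M"
      using M w0 powM by (auto simp: f_def unit_vec_def intro!: vec.subspace_scale)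
    show "orthonormal (f ` {..<r})"
      unfolding f_def using orthogonal_family_unit_vec[of "{..<r}" "\<lambda>i. pow i w"] orth pow_nz w0
      by auto
    show "\<exists>c. P *v b = c *s b" if "b \<in> f ` {..<r}" for b
    proof -
      obtain i where b: "b = f i" using \<open>b \<in> f ` {..<r}\<close> by blast
      have "P *v pow i w = shift i \<mu> 0 *s pow i w"
        using eig_pow[OF w, of i] by (auto simp: eig_def Q_def dest: spec[of _ 0])
      from transfer[OF this] show ?thesis by (simp add: b)
    qed
    show "\<exists>b'\<in>f ` {..<r}. \<exists>c. U *v b = c *s b'" if "b \<in> f ` {..<r}" for b
      using that cyc transfer by blast
    show "\<exists>b'\<in>f ` {..<r}. \<exists>c. conj_transpose U *v b = c *s b'" if "b \<in> f ` {..<r}" for b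
      using that cyc' transfer by blast
  qed
qed

text \<open>The orthogonal complement of the vectors found so far is invariant under
  \<open>P\<close>, \<open>U\<close> and the adjoint of \<open>U\<close>, so as long as it is
  nonzero another cycle can be found inside it.\<close>

lemma adapted_orthonormal_basis:
  fixes P U :: "complex^'n^'n"
  assumes P: "conj_transpose P = P" and U: "unitary U"
    and comm: "\<And>k. commutes (twist U P k) P"
  obtains B where "orthonormal B" "card B = CARD('n)" "\<And>b. b \<in> B \<Longrightarrow> \<exists>c. P *v b = c *s b"
    "\<And>b. b \<in> B \<Longrightarrow> \<exists>b'\<in>B. \<exists>c. conj_transpose U *v b = c *s b'"
proof -
  define R where "R B \<longleftrightarrow> (\<forall>b\<in>B. (\<exists>c. P *v b = c *s b) \<and> (\<exists>b'\<in>B. \<exists>c. U *v b = c *s b') \<and>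
      (\<exists>b'\<in>B. \<exists>c. conj_transpose U *v b = c *s b'))" for B
  have step: "\<exists>B'. B \<subset> B' \<and> orthonormal B' \<and> R B'"
    if B: "orthonormal B" "R B" and x: "x \<noteq> 0" "\<And>b. b \<in> B \<Longrightarrow> cinner x b = 0" for B x
  proof -
    let ?M = "{x. \<forall>b\<in>B. cinner x b = 0}"
    have M: "vec.subspace ?M" by (simp add: vec.subspace_def)
    \<comment> \<open>The complement of \<open>B\<close> is invariant under \<open>T\<close> as soon
      as the adjoint of \<open>T\<close> sends each element of \<open>B\<close> to a multiple of an
      element of \<open>B\<close>. This is why \<open>R\<close> records closure under both
      \<open>U\<close> and its adjoint.\<close>
    have inv: "T *v y \<in> ?M"
      if y: "y \<in> ?M" and T: "\<And>b. b \<in> B \<Longrightarrow> \<exists>b'\<in>B. \<exists>c. conj_transpose T *v b = c *s b'" for T y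
    proof -
      have "cinner (T *v y) b = 0" if b: "b \<in> B" for b
      proof -
        obtain b' c where "b' \<in> B" "conj_transpose T *v b = c *s b'" using T[OF b] by blast
        with y show ?thesis by (simp add: cinner_conj_transpose[of T])
      qed
      then show ?thesis by blast
    qed
    have "P *v y \<in> ?M" if "y \<in> ?M" for y
      by (rule inv[OF that], unfold P) (use B(2)[unfolded R_def] that in blast)
    moreover have "U *v y \<in> ?M" if "y \<in> ?M" for y
      by (rule inv[OF that]) (use B(2) R_def in blast)
    moreover have "conj_transpose U *v y \<in> ?M" if "y \<in> ?M" for y
      by (rule inv[OF that]) (use B(2) R_def in auto)
    moreover have "x \<in> ?M" using x by simp
    ultimately obtain C where C: "C \<noteq> {}" "C \<subseteq> ?M" "orthonormal C"
      "\<And>b. b \<in> C \<Longrightarrow> \<exists>c. P *v b = c *s b" "\<And>b. b \<in> C \<Longrightarrow> \<exists>b'\<in>C. \<exists>c. U *v b = c *s b'"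
      "\<And>b. b \<in> C \<Longrightarrow> \<exists>b'\<in>C. \<exists>c. conj_transpose U *v b = c *s b'"
      using adapted_orthonormal_set[OF P U comm M, of x] x(1) by (smt (verit))
    have cross: "cinner c b = 0" "cinner b c = 0" if "c \<in> C" "b \<in> B" for b c
      using C(2) that cnj_cinner[of c b] by auto
    have disj: "b \<notin> C" if "b \<in> B" for b
    proof
      assume "b \<in> C"
      then have "cinner b b = 0" using cross that by blast
      moreover have "cinner b b = of_bool (b = b)"
        using B(1) that unfolding orthonormal_def by blast
      ultimately show False by (simp del: cinner_self_eq_0)
    qed
    have "orthonormal (B \<union> C)"
      using B(1) C(3) cross disj unfolding orthonormal_def by (metis UnE of_bool_eq(1))
    moreover have "R (B \<union> C)" using B(2) C(4-6) unfolding R_def ball_Un bex_Un by simp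
    moreover have "B \<subset> B \<union> C" using C(1) disj by blast
    ultimately show ?thesis by blast
  qed
  obtain B where "orthonormal B" "R B" "card B = CARD('n)"
    using orthonormal_basis_by_extension[of R] step by (auto simp: R_def)
  with that show thesis by (auto simp: R_def)
qed

subsection \<open>Monomial matrices\<close>

text \<open>Weights are indexed by columns and may vanish. Multiplication composes the underlying
  maps, and \<open>id\<close> gives the diagonal matrices.\<close>

definition monomial_mat :: "('n \<Rightarrow> 'n) \<Rightarrow> ('n \<Rightarrow> complex) \<Rightarrow> complex^'n^'n" where
  "monomial_mat \<pi> d = (\<chi> i j. if i = \<pi> j then d j else 0)"

abbreviation diag_mat :: "('n \<Rightarrow> complex) \<Rightarrow> complex^'n^'n" where
  "diag_mat \<equiv> monomial_mat id"

lemma monomial_mat_mult: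
  "monomial_mat \<pi> c ** monomial_mat \<sigma> d = monomial_mat (\<pi> \<circ> \<sigma>) (\<lambda>j. c (\<sigma> j) * d j)"
  by (simp add: monomial_mat_def matrix_matrix_mult_def vec_eq_iff mult_delta_right sum.delta)

lemma conj_transpose_monomial_mat:
  "bij \<pi> \<Longrightarrow> conj_transpose (monomial_mat \<pi> d) = monomial_mat (inv \<pi>) (\<lambda>i. cnj (d (inv \<pi> i)))"
  by (auto simp: monomial_mat_def conj_transpose_def vec_eq_iff bij_inv_eq_iff bij_is_inj)

lemma diag_mat_1: "diag_mat (\<lambda>_. 1) = mat 1"
  by (simp add: monomial_mat_def mat_def)

lemma unitary_monomial_mat:
  assumes "bij \<pi>" "\<And>j. cmod (d j) = 1"
  shows "unitary (monomial_mat \<pi> d)"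
proof -
  have "cnj (d j) * d j = 1" for j
    using assms(2)[of j] by (simp add: mult.commute[of "cnj _"] flip: complex_norm_square)
  then have "conj_transpose (monomial_mat \<pi> d) ** monomial_mat \<pi> d = mat 1"
    using assms(1)
    by (simp add: conj_transpose_monomial_mat monomial_mat_mult bij_is_inj inv_o_cancel diag_mat_1)
  then show ?thesis
    using matrix_left_right_inverse by (auto simp: unitary_def)
qed

text \<open>The positions of the nonzero entries form an injective partial map from columns to rows,
  which extends to a permutation; the added positions carry weight 0.\<close>

lemma weighted_permutation_iff_monomial:
  fixes B :: "complex^'n^'n"
  shows "weighted_permutation B \<longleftrightarrow> (\<exists>\<pi> d. bij \<pi> \<and> B = monomial_mat \<pi> d)"
proof
  assume B: "weighted_permutation B"
  have row: "j = j'" if "B $ i $ j \<noteq> 0" "B $ i $ j' \<noteq> 0" for i j j'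
    using B that card_le_Suc0_iff_eq[of "{j. B $ i $ j \<noteq> 0}"]
    by (auto simp: weighted_permutation_def)
  have col: "i = i'" if "B $ i $ j \<noteq> 0" "B $ i' $ j \<noteq> 0" for i i' j
    using B that card_le_Suc0_iff_eq[of "{i. B $ i $ j \<noteq> 0}"]
    by (auto simp: weighted_permutation_def)
  define J where "J = {j. \<exists>i. B $ i $ j \<noteq> 0}"
  define f where "f j = (SOME i. B $ i $ j \<noteq> 0)" for j
  have f: "B $ f j $ j \<noteq> 0" if "j \<in> J" for j
    using that unfolding J_def f_def mem_Collect_eq by (rule someI_ex)
  have inj: "inj_on f J" using f row by (metis inj_onI)
  \<comment> \<open>There are as many zero columns as zero rows, so any bijection \<open>g\<close>
    between them completes \<open>f\<close>.\<close>
  have "card (UNIV - J) = card (UNIV - f ` J)"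
    by (simp add: card_Diff_subset card_image[OF inj])
  then obtain g where g: "bij_betw g (UNIV - J) (UNIV - f ` J)"
    using finite_same_card_bij[of "UNIV - J" "UNIV - f ` J"] by auto
  define \<pi> where "\<pi> j = (if j \<in> J then f j else g j)" for j
  have "bij_betw \<pi> J (f ` J)"
    using inj by (auto simp: \<pi>_def bij_betw_def inj_on_def)
  moreover have "bij_betw \<pi> (UNIV - J) (UNIV - f ` J)"
    using g by (subst bij_betw_cong[of _ \<pi> g]) (auto simp: \<pi>_def)
  ultimately have "bij_betw \<pi> (J \<union> (UNIV - J)) (f ` J \<union> (UNIV - f ` J))"
    by (rule bij_betw_combine) auto
  then have "bij \<pi>" by simp
  moreover have "B $ i $ j = (if i = \<pi> j then B $ \<pi> j $ j else 0)" for i j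
    using f[of j] col[of i j "f j"] by (auto simp: \<pi>_def J_def)
  then have "B = monomial_mat \<pi> (\<lambda>j. B $ \<pi> j $ j)"
    unfolding monomial_mat_def vec_eq_iff vec_lambda_beta by blast
  ultimately show "\<exists>\<pi> d. bij \<pi> \<and> B = monomial_mat \<pi> d" by blast
next
  assume "\<exists>\<pi> d. bij \<pi> \<and> B = monomial_mat \<pi> d"
  then obtain \<pi> d where \<pi>: "bij \<pi>" and B: "B = monomial_mat \<pi> d" by blast
  have "card {j. B $ i $ j \<noteq> 0} \<le> card {inv \<pi> i}" for i
    by (rule card_mono) (auto simp: B monomial_mat_def inv_f_f[OF bij_is_inj[OF \<pi>]])
  moreover have "card {i. B $ i $ j \<noteq> 0} \<le> card {\<pi> j}" for j
    by (rule card_mono) (auto simp: B monomial_mat_def)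
  ultimately show "weighted_permutation B" by (simp add: weighted_permutation_def)
qed

subsection \<open>Positive semidefinite square roots\<close>

lemma unitary_conj_eq_iff:
  assumes "unitary W"
  shows "conj_transpose W ** A ** W = D \<longleftrightarrow> A = W ** D ** conj_transpose W"
  using assms by (auto simp: matrix_mul_assoc[symmetric] unitaryD)

lemma positive_semidefinite_cinner:
  "positive_semidefinite P \<longleftrightarrow> conj_transpose P = P \<and> (\<forall>x. 0 \<le> Re (cinner (P *v x) x))"
  by (simp add: positive_semidefinite_def cinner_def)

text \<open>For U = 1 all twists equal \<open>P\<close>, and the adapted basis is an eigenbasis of
  \<open>P\<close>.\<close>

lemma spectral_decomposition:
  fixes P :: "complex^'n^'n"
  assumes P: "conj_transpose P = P"
  obtains W d where "unitary W" "P = W ** diag_mat d ** conj_transpose W"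
proof -
  have "matrix_power (mat 1) k = (mat 1 :: complex^'n^'n)" for k
    by (induction k) (simp_all add: matrix_power_Suc)
  then have "commutes (twist (mat 1) P k) P" for k by (simp add: twist_def commutes_def)
  then obtain B where B: "orthonormal B" "card B = CARD('n)" "\<And>b. b \<in> B \<Longrightarrow> \<exists>c. P *v b = c *s b"
    using adapted_orthonormal_basis[OF P unitary_mat_1] by blast
  obtain W w where W: "unitary W" and w: "bij_betw w UNIV B"
      and on: "\<And>i j. cinner (w j) (w i) = of_bool (i = j)"
      and entry: "\<And>A i j. (conj_transpose W ** A ** W) $ i $ j = cinner (A *v w j) (w i)"
    using orthonormal_basis_unitary[OF B(1,2)] by metis
  have "\<exists>c. P *v w j = c *s w j" for j using B(3) w by (auto simp: bij_betw_def)
  then obtain d where "\<And>j. P *v w j = d j *s w j" by metis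
  then have "(conj_transpose W ** P ** W) $ i $ j = diag_mat d $ i $ j" for i j
    by (simp add: entry on monomial_mat_def)
  then have "conj_transpose W ** P ** W = diag_mat d" by (simp only: vec_eq_iff) blast
  with W that show thesis by (simp add: unitary_conj_eq_iff)
qed

lemma diag_mat_mult_vec: "diag_mat d *v x = (\<chi> i. d i * x $ i)"
  by (simp add: monomial_mat_def matrix_vector_mult_def mult_delta_left sum.delta)

lemma diag_mat_mult_axis: "diag_mat d *v axis i 1 = d i *s axis i 1"
  by (simp add: diag_mat_mult_vec axis_def vec_eq_iff)

lemma cinner_axis_left: "cinner (axis i 1) y = cnj (y $ i)"
  by (simp add: cinner_def axis_def mult_delta_left sum.delta)

lemma matrix_vector_mult_axis: "(A *v axis j (1 :: complex)) $ i = A $ i $ j"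
  by (simp add: matrix_vector_mult_def axis_def mult_delta_right sum.delta)

lemma cinner_diag_mat:
  "cinner (diag_mat d *v x) x = (\<Sum>i\<in>UNIV. d i * complex_of_real ((cmod (x $ i))\<^sup>2))"
  unfolding complex_norm_square by (simp add: cinner_def diag_mat_mult_vec mult.assoc)

lemma conj_transpose_diag_mat: "conj_transpose (diag_mat d) = diag_mat (\<lambda>i. cnj (d i))"
  by (simp add: conj_transpose_monomial_mat inv_id)

lemma positive_semidefinite_conj_diag:
  assumes "\<And>i. 0 \<le> r i"
  shows "positive_semidefinite (W ** diag_mat (\<lambda>i. complex_of_real (r i)) ** conj_transpose W)"
proof -
  have "0 \<le> Re (cinner ((W ** diag_mat (\<lambda>i. complex_of_real (r i)) ** conj_transpose W) *v x) x)" for x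
    using assms
    by (simp add: matrix_vector_mul_assoc[symmetric] cinner_conj_transpose[of W] cinner_diag_mat sum_nonneg)
  then show ?thesis
    by (simp add: positive_semidefinite_cinner conj_transpose_mult matrix_mul_assoc conj_transpose_diag_mat)
qed

lemma positive_semidefinite_gram: "positive_semidefinite (conj_transpose T ** T)"
proof -
  have "cinner ((conj_transpose T ** T) *v x) x = cinner (T *v x) (T *v x)" for x
    by (simp add: matrix_vector_mul_assoc[symmetric] cinner_conj_transpose[of "conj_transpose T"])
  then show ?thesis
    by (simp add: positive_semidefinite_cinner conj_transpose_mult Re_cinner_self_nonneg)
qed

lemma positive_semidefinite_spectral:
  assumes P: "positive_semidefinite P"
  obtains W r where "unitary W" "\<And>i. 0 \<le> r i"
    "P = W ** diag_mat (\<lambda>i. complex_of_real (r i)) ** conj_transpose W"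
proof -
  obtain W d where W: "unitary W" and PW: "P = W ** diag_mat d ** conj_transpose W"
    using P spectral_decomposition by (metis positive_semidefinite_cinner)
  \<comment> \<open>The diagonal entries are values of the quadratic form of \<open>P\<close> at the
    columns of \<open>W\<close>, hence real and nonnegative.\<close>
  have d: "d i = cinner (P *v (W *v axis i 1)) (W *v axis i 1)" for i
  proof -
    have "P *v (W *v axis i 1) = W *v (diag_mat d *v axis i 1)"
      using W by (simp add: PW matrix_vector_mul_assoc matrix_mul_assoc[symmetric] unitaryD)
    then have "cinner (P *v (W *v axis i 1)) (W *v axis i 1) = cinner (diag_mat d *v axis i 1) (axis i 1)"
      using W by (simp add: cinner_unitary)
    also have "\<dots> = d i"
      by (simp add: diag_mat_mult_axis cinner_axis_left)
    finally show ?thesis by simp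
  qed
  have "cnj (d i) = d i" for i
    using P unfolding d cnj_cinner by (simp add: positive_semidefinite_cinner hermitian_cinner)
  then have "d = (\<lambda>i. complex_of_real (Re (d i)))"
    by (simp add: fun_eq_iff complex_eq_iff)
  moreover have "0 \<le> Re (d i)" for i
    using P unfolding d by (simp add: positive_semidefinite_cinner)
  ultimately show thesis using that[of W "\<lambda>i. Re (d i)"] W PW by simp
qed

lemma matrix_eq_on_unitary_columns:
  assumes W: "unitary W" and eq: "\<And>i. A *v (W *v axis i 1) = B *v (W *v axis i 1)"
  shows "A = B"
proof -
  have "A ** W = B ** W"
    unfolding vec_eq_iff using eq
    by (metis matrix_vector_mul_assoc matrix_vector_mult_axis)
  then have "A ** W ** conj_transpose W = B ** W ** conj_transpose W" by simp
  with W show ?thesis by (simp add: matrix_mul_assoc[symmetric] unitaryD)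
qed

text \<open>Let P v = r v and w = Q v - r v. Then Q w = - r w, so positivity of \<open>Q\<close>
  forces w = 0 if r > 0. If r = 0, the squared norm of Q v is the inner product of v with Q (Q v) =
  0. Hence both matrices agree on an eigenbasis of \<open>P\<close>.\<close>

lemma positive_semidefinite_sqrt_unique:
  assumes P: "positive_semidefinite P" and Q: "positive_semidefinite Q" and eq: "P ** P = Q ** Q"
  shows "P = Q"
proof -
  obtain W r where W: "unitary W" and r: "\<And>i. 0 \<le> r i"
    and PW: "P = W ** diag_mat (\<lambda>i. complex_of_real (r i)) ** conj_transpose W"
    using positive_semidefinite_spectral[OF P] by metis
  show ?thesis
  proof (rule matrix_eq_on_unitary_columns[OF W])
    fix i
    let ?v = "W *v axis i 1" and ?r = "complex_of_real (r i)"
    have Pv: "P *v ?v = ?r *s ?v"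
      using W by (simp add: PW matrix_vector_mul_assoc[symmetric] unitary_vecD vector_scalar_commute
          diag_mat_mult_axis)
    have "Q *v (Q *v ?v) = P *v (P *v ?v)"
      by (simp only: matrix_vector_mul_assoc matrix_mul_assoc eq)
    then have QQ: "Q *v (Q *v ?v) = ?r *s (?r *s ?v)"
      by (simp only: Pv vector_scalar_commute)
    have H: "cinner (Q *v x) y = cinner x (Q *v y)" for x y
      using Q by (simp add: positive_semidefinite_cinner hermitian_cinner)
    define w where "w = Q *v ?v - ?r *s ?v"
    have "w = 0"
    proof (cases "r i = 0")
      case True
      then have "cinner (Q *v ?v) (Q *v ?v) = 0" using H[of ?v "Q *v ?v"] by (simp add: QQ)
      then show ?thesis using True by (simp add: w_def)
    next
      case False
      then have "0 < r i" using r[of i] by simp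
      have "Q *v w = - ?r *s w"
        by (simp add: w_def matrix_vector_mult_diff_distrib QQ vector_scalar_commute
            vec.scale_right_diff_distrib)
      then have "cinner (Q *v w) w = - ?r * cinner w w" by (simp only: cinner_simps)
      then have "Re (cinner (Q *v w) w) = - r i * Re (cinner w w)" by simp
      moreover have "0 \<le> Re (cinner (Q *v w) w)"
        using Q by (simp add: positive_semidefinite_cinner)
      ultimately have "\<not> 0 < Re (cinner w w)"
        using \<open>0 < r i\<close> by (simp add: mult_le_0_iff)
      then show ?thesis using Re_cinner_self_pos by blast
    qed
    then show "P *v ?v = Q *v ?v" by (simp add: Pv w_def)
  qed
qed

lemma psd_sqrt_eqI:
  "positive_semidefinite P \<Longrightarrow> P ** P = M \<Longrightarrow> psd_sqrt M = P"
  unfolding psd_sqrt_def by (rule the_equality) (auto intro: positive_semidefinite_sqrt_unique)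

subsection \<open>Singular values\<close>

lemma poly_charpoly: "poly (charpoly A) z = det (mat z - A)"
proof -
  have "poly ((if i = j then [:0, 1:] else 0) - [:A $ i $ j:]) z = (mat z - A) $ i $ j" for i j
    by (simp add: mat_def)
  then show ?thesis
    by (simp add: charpoly_def det_def poly_sum poly_prod of_int_poly del: poly_diff)
qed

text \<open>Complex polynomials are determined by their values, so it suffices to compare
  determinants at each z, where the scalar matrix is unchanged by the conjugation.\<close>

lemma charpoly_unitary_conj:
  assumes W: "unitary W"
  shows "charpoly (W ** A ** conj_transpose W) = charpoly A"
proof -
  have "det (mat z - W ** A ** conj_transpose W) = det (mat z - A)" for z
  proof -
    have "W ** mat z ** conj_transpose W = mat z"
    proof -
      have "W ** mat z = mat z ** W"
        by (simp add: matrix_matrix_mult_def mat_def vec_eq_iff if_distrib if_distribR sum.delta mult.commute cong: if_cong)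
      then show ?thesis using W by (simp add: matrix_mul_assoc[symmetric] unitaryD)
    qed
    moreover have "W ** (mat z - A) ** conj_transpose W
        = W ** mat z ** conj_transpose W - W ** A ** conj_transpose W"
      by (simp add: matrix_matrix_mult_def vec_eq_iff sum_subtractf algebra_simps sum_distrib_left)
    ultimately have "mat z - W ** A ** conj_transpose W = W ** (mat z - A) ** conj_transpose W"
      by simp
    moreover have "det W * det (conj_transpose W) = 1"
      using W by (metis det_mul det_I unitary_def)
    ultimately show ?thesis by (simp add: det_mul mult.commute mult.left_commute)
  qed
  then have "poly (charpoly (W ** A ** conj_transpose W)) = poly (charpoly A)"
    by (simp add: fun_eq_iff poly_charpoly)
  then show ?thesis by (simp only: poly_eq_poly_eq_iff)
qed

lemma count_eigenvalues_diag: "count (eigenvalues (diag_mat d)) s = card {i. d i = s}"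
proof -
  have "charpoly (diag_mat d) = (\<Prod>i\<in>UNIV. [:- d i, 1:])"
    unfolding charpoly_def by (subst det_diagonal) (auto simp: monomial_mat_def)
  then have "eigenvalues (diag_mat d) = (\<Sum>i\<in>UNIV. {#d i#})"
    by (simp add: eigenvalues_def proots_prod)
  moreover have "count {#d i#} s = of_bool (d i = s)" for i by simp
  ultimately have "count (eigenvalues (diag_mat d)) s = (\<Sum>i\<in>UNIV. of_bool (d i = s))"
    by (simp only: count_sum)
  then show ?thesis by simp
qed

text \<open>Uniqueness identifies the square root as the conjugate by \<open>W\<close> of the
  diagonal matrix with entries \<open>r i\<close>. These are thus the singular values with
  multiplicity, and simplicity means that \<open>r\<close> is injective.\<close>

lemma distinct_singular_values_iff:
  fixes T :: "complex^'n^'n"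
  assumes W: "unitary W" and r: "\<And>i. 0 \<le> r i"
    and T: "conj_transpose T ** T = W ** diag_mat (\<lambda>i. complex_of_real ((r i)\<^sup>2)) ** conj_transpose W"
  shows "distinct_singular_values T \<longleftrightarrow> inj r"
proof -
  let ?D = "diag_mat (\<lambda>i. complex_of_real (r i))"
  have "psd_sqrt (conj_transpose T ** T) = W ** ?D ** conj_transpose W"
  proof (rule psd_sqrt_eqI)
    show "positive_semidefinite (W ** ?D ** conj_transpose W)"
      using r by (rule positive_semidefinite_conj_diag)
    have "W ** ?D ** conj_transpose W ** (W ** ?D ** conj_transpose W) = W ** (?D ** ?D) ** conj_transpose W"
      using W by (simp add: matrix_mul_assoc[symmetric] unitaryD)
    then show "W ** ?D ** conj_transpose W ** (W ** ?D ** conj_transpose W) = conj_transpose T ** T"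
      by (simp add: T monomial_mat_mult power2_eq_square)
  qed
  then have "count (singular_values T) s = card {i. complex_of_real (r i) = s}" for s
    using W by (simp add: singular_values_def eigenvalues_def charpoly_unitary_conj
        flip: count_eigenvalues_diag)
  moreover have "(\<forall>s. card {i. complex_of_real (r i) = s} \<le> 1) \<longleftrightarrow> inj r"
  proof
    assume "\<forall>s. card {i. complex_of_real (r i) = s} \<le> 1"
    then have "\<forall>s. \<forall>i\<in>{i. complex_of_real (r i) = s}. \<forall>j\<in>{i. complex_of_real (r i) = s}. i = j"
      by (simp add: card_le_Suc0_iff_eq)
    then show "inj r" by (auto intro: injI)
  next
    assume "inj r"
    then show "\<forall>s. card {i. complex_of_real (r i) = s} \<le> 1"
      by (auto simp: card_le_Suc0_iff_eq dest: injD)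
  qed
  ultimately show ?thesis by (simp add: distinct_singular_values_def)
qed

section \<open>Half-normality, and the weighted permutation form for distinct singular
  values\<close>

lemma gram_unitary_conj:
  assumes "unitary W"
  shows "conj_transpose (conj_transpose W ** T ** W) ** (conj_transpose W ** T ** W)
      = conj_transpose W ** (conj_transpose T ** T) ** W"
    and "(conj_transpose W ** T ** W) ** conj_transpose (conj_transpose W ** T ** W)
      = conj_transpose W ** (T ** conj_transpose T) ** W"
  using assms by (simp_all add: conj_transpose_mult matrix_mul_assoc[symmetric] unitaryD)

lemma half_normal_unitary_conj:
  assumes W: "unitary W" and T: "half_normal T"
  shows "half_normal (conj_transpose W ** T ** W)"
proof -
  have mult: "(conj_transpose W ** A ** W) ** (conj_transpose W ** B ** W)
      = conj_transpose W ** (A ** B) ** W" for A B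
    using W by (simp add: matrix_mul_assoc[symmetric] unitaryD)
  show ?thesis
    using T unfolding half_normal_def commutes_def gram_unitary_conj[OF W] mult by simp
qed

text \<open>For a monomial matrix both Gram products are diagonal.\<close>

lemma half_normal_monomial_mat:
  assumes "bij \<pi>"
  shows "half_normal (monomial_mat \<pi> d)"
  using bij_is_inj[OF assms] bij_is_surj[OF assms]
  by (simp add: half_normal_def commutes_def conj_transpose_monomial_mat[OF assms]
      monomial_mat_mult surj_iff inv_o_cancel mult.commute)

lemma weighted_permutationI:
  assumes "\<And>i j j'. B $ i $ j \<noteq> 0 \<Longrightarrow> B $ i $ j' \<noteq> 0 \<Longrightarrow> j = j'"
    and "\<And>i i' j. B $ i $ j \<noteq> 0 \<Longrightarrow> B $ i' $ j \<noteq> 0 \<Longrightarrow> i = i'"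
  shows "weighted_permutation B"
  unfolding weighted_permutation_def One_nat_def
  using assms by (auto simp: card_le_Suc0_iff_eq)

lemma diag_mat_mult_left: "(diag_mat d ** A) $ i $ j = d i * A $ i $ j"
  by (simp add: monomial_mat_def matrix_matrix_mult_def mult_delta_left sum.delta)

lemma diag_mat_mult_right: "(A ** diag_mat d) $ i $ j = A $ i $ j * d j"
  by (simp add: monomial_mat_def matrix_matrix_mult_def mult_delta_right sum.delta')

lemma commutes_diag_inj:
  assumes "commutes (diag_mat d) A" and "inj d" and "i \<noteq> j"
  shows "A $ i $ j = 0"
proof -
  have "d i * A $ i $ j = A $ i $ j * d j"
    using assms(1) by (metis commutes_def diag_mat_mult_left diag_mat_mult_right)
  moreover have "d i \<noteq> d j" using assms(2,3) by (auto dest: injD)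
  ultimately show ?thesis by (simp add: mult.commute)
qed

lemma distinct_half_normal_weighted_permutation:
  fixes T :: "complex^'n^'n"
  assumes T: "half_normal T" and dist: "distinct_singular_values T"
  obtains W where "unitary W" "weighted_permutation (conj_transpose W ** T ** W)"
proof -
  obtain W s where W: "unitary W" and s: "\<And>i. 0 \<le> s i"
    and TT: "conj_transpose T ** T = W ** diag_mat (\<lambda>i. complex_of_real (s i)) ** conj_transpose W"
    using positive_semidefinite_spectral[OF positive_semidefinite_gram[of T]] by metis
  have "inj (\<lambda>i. sqrt (s i))"
    using dist distinct_singular_values_iff[OF W, of "\<lambda>i. sqrt (s i)" T] s by (simp add: TT)
  then have "inj s" by (auto simp: inj_def)
  define d where "d i = complex_of_real (s i)" for i
  have "inj d" using \<open>inj s\<close> by (auto simp: inj_def d_def)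
  define B where "B = conj_transpose W ** T ** W"
  have BB: "conj_transpose B ** B = diag_mat d"
    unfolding B_def gram_unitary_conj(1)[OF W] TT unitary_conj_eq_iff[OF W] d_def ..
  have "half_normal B" unfolding B_def by (rule half_normal_unitary_conj[OF W T])
  then have off: "(B ** conj_transpose B) $ i $ j = 0" if "i \<noteq> j" for i j
    using commutes_diag_inj[OF _ \<open>inj d\<close> that] by (simp add: half_normal_def BB)
  define c where "c i = (B ** conj_transpose B) $ i $ i" for i
  have cB: "B ** conj_transpose B = diag_mat c"
    using off by (simp add: vec_eq_iff monomial_mat_def c_def)
  \<comment> \<open>Both sides are the product of \<open>B\<close>, its adjoint and
    \<open>B\<close>, bracketed differently. Comparing entries links \<open>c i\<close> to
    \<open>d j\<close> wherever \<open>B\<close> has a nonzero entry, and injectivity of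
    \<open>d\<close> leaves one such j per row.\<close>
  have "diag_mat c ** B = B ** diag_mat d"
    by (simp add: matrix_mul_assoc flip: cB BB)
  then have cd: "c i = d j" if "B $ i $ j \<noteq> 0" for i j
    using that by (metis diag_mat_mult_left diag_mat_mult_right mult.commute mult_cancel_left)
  have row: "j = j'" if "B $ i $ j \<noteq> 0" "B $ i $ j' \<noteq> 0" for i j j'
    using cd[OF that(1)] cd[OF that(2)] \<open>inj d\<close> by (metis injD)
  have "weighted_permutation B"
  proof (rule weighted_permutationI)
    fix i i' j assume nz: "B $ i $ j \<noteq> 0" "B $ i' $ j \<noteq> 0"
    \<comment> \<open>Since row i is supported in column j, the entry of the second Gram product at
      (i, i') is a single nonzero product; that matrix is diagonal, so i = i'.\<close>
    have zero: "B $ i $ k = 0" if "k \<noteq> j" for k using row nz(1) that by blast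
    have "(B ** conj_transpose B) $ i $ i' = (\<Sum>k\<in>UNIV. B $ i $ k * cnj (B $ i' $ k))"
      by (simp add: matrix_matrix_mult_def conj_transpose_def)
    also have "\<dots> = (\<Sum>k\<in>{j}. B $ i $ k * cnj (B $ i' $ k))"
      by (rule sum.mono_neutral_right) (auto simp: zero)
    finally show "i = i'" using off nz by force
  qed (rule row)
  with W that B_def show thesis by blast
qed

subsection \<open>Polar decompositions with commuting twists\<close>

text \<open>Condition (3) for a given pair of factors.\<close>

definition commuting_polar :: "complex^'n^'n \<Rightarrow> complex^'n^'n \<Rightarrow> complex^'n^'n \<Rightarrow> bool" where
  "commuting_polar A P U \<longleftrightarrow>
     positive_semidefinite P \<and> unitary U \<and> A = P ** U \<and> (\<forall>k. commutes (twist U P k) P)"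

text \<open>The value 1 at 0 keeps the phase unimodular, so that the monomial matrix of phases is
  unitary even when some weights vanish.\<close>

definition phase :: "complex \<Rightarrow> complex" where
  "phase z = (if z = 0 then 1 else sgn z)"

lemma cmod_phase [simp]: "cmod (phase z) = 1"
  by (simp add: phase_def norm_sgn)

lemma cmod_times_phase: "complex_of_real (cmod z) * phase z = z"
  by (simp add: phase_def sgn_eq)

text \<open>Put the moduli of the weights into \<open>P\<close> and the phases into
  \<open>U\<close>. Conjugation by a monomial unitary keeps diagonal matrices diagonal, so all
  twists are diagonal in the same basis and commute.\<close>

lemma monomial_commuting_polar:
  fixes W :: "complex^'n^'n"
  assumes W: "unitary W" and \<pi>: "bij \<pi>"
    and A: "A = W ** monomial_mat \<pi> d ** conj_transpose W"
  shows "\<exists>P U. commuting_polar A P U"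
proof -
  \<comment> \<open>As \<open>P\<close> stands on the left, the moduli must be indexed by rows,
    whence \<open>inv \<pi>\<close>.\<close>
  define P0 :: "complex^'n^'n" where "P0 = diag_mat (\<lambda>i. complex_of_real (cmod (d (inv \<pi> i))))"
  define U0 where "U0 = monomial_mat \<pi> (\<lambda>j. phase (d j))"
  define P where "P = W ** P0 ** conj_transpose W"
  define U where "U = W ** U0 ** conj_transpose W"
  have mult: "(W ** X ** conj_transpose W) ** (W ** Y ** conj_transpose W)
      = W ** (X ** Y) ** conj_transpose W" for X Y
    using W by (simp add: matrix_mul_assoc[symmetric] unitaryD)
  have "P0 ** U0 = monomial_mat \<pi> d"
    using \<pi> by (simp add: P0_def U0_def monomial_mat_mult bij_is_inj cmod_times_phase)
  then have "A = P ** U" by (simp add: A P_def U_def mult)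
  moreover have "positive_semidefinite P"
    unfolding P_def P0_def by (rule positive_semidefinite_conj_diag) simp
  moreover have "unitary U0" unfolding U0_def using \<pi> by (rule unitary_monomial_mat) simp
  then have "unitary U"
    unfolding U_def using W by (intro unitary_mult unitary_conj_transpose)
  moreover have "commutes (twist U P k) P" for k
  proof -
    have "\<exists>q. twist U P k = W ** diag_mat q ** conj_transpose W"
    proof (induction k)
      case 0
      show ?case unfolding twist_0 P_def P0_def by blast
    next
      case (Suc k)
      then obtain q where "twist U P k = W ** diag_mat q ** conj_transpose W" by blast
      moreover have "conj_transpose U = W ** conj_transpose U0 ** conj_transpose W"
        by (simp add: U_def conj_transpose_mult matrix_mul_assoc)
      ultimately have "twist U P (Suc k) = W ** (conj_transpose U0 ** diag_mat q ** U0) ** conj_transpose W"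
        unfolding twist_Suc by (simp add: U_def mult)
      moreover have "\<exists>q'. conj_transpose U0 ** diag_mat q ** U0 = diag_mat q'"
        using \<pi> by (auto simp: U0_def conj_transpose_monomial_mat monomial_mat_mult bij_is_inj inv_o_cancel)
      ultimately show ?case by metis
    qed
    then obtain q where "twist U P k = W ** diag_mat q ** conj_transpose W" by blast
    then show ?thesis
      by (simp add: commutes_def P_def P0_def mult monomial_mat_mult mult.commute)
  qed
  ultimately show ?thesis unfolding commuting_polar_def by blast
qed

text \<open>In the adapted basis \<open>P\<close> is diagonal and the adjoint of \<open>U\<close>
  sends each basis vector to a multiple of another one, so row i of the matrix of \<open>A\<close>
  can be nonzero only in column \<open>\<sigma> i\<close>.\<close>

lemma commuting_polar_weighted_permutation:
  fixes A :: "complex^'n^'n"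
  assumes "commuting_polar A P U"
  obtains W where "unitary W" "weighted_permutation (conj_transpose W ** A ** W)"
proof -
  have P: "conj_transpose P = P" and U: "unitary U" and A: "A = P ** U"
    and comm: "\<And>k. commutes (twist U P k) P"
    using assms by (auto simp: commuting_polar_def positive_semidefinite_cinner)
  obtain B where B: "orthonormal B" "card B = CARD('n)" "\<And>b. b \<in> B \<Longrightarrow> \<exists>c. P *v b = c *s b"
      "\<And>b. b \<in> B \<Longrightarrow> \<exists>b'\<in>B. \<exists>c. conj_transpose U *v b = c *s b'"
    using adapted_orthonormal_basis[OF P U comm] by blast
  obtain W w where W: "unitary W" and w: "bij_betw w UNIV B"
      and on: "\<And>i j. cinner (w j) (w i) = of_bool (i = j)"
      and entry: "\<And>A i j. (conj_transpose W ** A ** W) $ i $ j = cinner (A *v w j) (w i)"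
    using orthonormal_basis_unitary[OF B(1,2)] by metis
  have "\<exists>c. P *v w i = c *s w i" for i using B(3) w by (auto simp: bij_betw_def)
  then obtain p where p: "\<And>i. P *v w i = p i *s w i" by metis
  have "\<exists>j c. conj_transpose U *v w i = c *s w j" for i
    using B(4)[of "w i"] w by (auto simp: bij_betw_def)
  then obtain \<sigma> c where Uw: "\<And>i. conj_transpose U *v w i = c i *s w (\<sigma> i)" by metis
  have ij: "(conj_transpose W ** A ** W) $ i $ j = cnj (p i) * cnj (c i) * of_bool (\<sigma> i = j)" for i j
  proof -
    have "(conj_transpose W ** A ** W) $ i $ j = cinner (P *v (U *v w j)) (w i)"
      by (simp add: entry A matrix_vector_mul_assoc)
    also have "\<dots> = cnj (p i) * cinner (w j) (conj_transpose U *v w i)"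
      by (simp add: hermitian_cinner[OF P] p cinner_conj_transpose[of U])
    finally show ?thesis by (simp add: Uw on)
  qed
  have "weighted_permutation (conj_transpose W ** A ** W)"
  proof (rule weighted_permutationI)
    fix i j j'
    assume "(conj_transpose W ** A ** W) $ i $ j \<noteq> 0" "(conj_transpose W ** A ** W) $ i $ j' \<noteq> 0"
    then show "j = j'" by (simp add: ij)
  next
    fix i i' j
    assume nz: "(conj_transpose W ** A ** W) $ i $ j \<noteq> 0" "(conj_transpose W ** A ** W) $ i' $ j \<noteq> 0"
    then have j: "\<sigma> i = j" "\<sigma> i' = j" "c i \<noteq> 0" "c i' \<noteq> 0" by (auto simp: ij)
    \<comment> \<open>The adjoint of \<open>U\<close> preserves inner products, so it cannot send
      two orthogonal vectors to nonzero multiples of the same vector.\<close>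
    have "cinner (w i) (w i') = cinner (conj_transpose U *v w i) (conj_transpose U *v w i')"
      by (simp only: cinner_unitary[OF unitary_conj_transpose[OF U]])
    also have "\<dots> = c i * cnj (c i')" by (simp add: Uw j on)
    finally show "i = i'" using j on[of i i'] by (cases "i = i'") simp_all
  qed
  with W that show thesis by blast
qed

subsection \<open>Limits\<close>

lemma tendsto_matrix_mult:
  fixes A B :: "complex^'n^'n"
  shows "(f \<longlongrightarrow> A) F \<Longrightarrow> (g \<longlongrightarrow> B) F \<Longrightarrow> ((\<lambda>n. f n ** g n) \<longlongrightarrow> A ** B) F"
  unfolding matrix_matrix_mult_def
  by (intro tendsto_vec_lambda tendsto_sum tendsto_mult tendsto_vec_nth)

lemma tendsto_conj_transpose:
  "(f \<longlongrightarrow> A) F \<Longrightarrow> ((\<lambda>n. conj_transpose (f n)) \<longlongrightarrow> conj_transpose A) F"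
  unfolding conj_transpose_def by (intro tendsto_vec_lambda tendsto_cnj tendsto_vec_nth)

lemma tendsto_matrix_power:
  fixes A :: "complex^'n^'n"
  shows "(f \<longlongrightarrow> A) F \<Longrightarrow> ((\<lambda>n. matrix_power (f n) k) \<longlongrightarrow> matrix_power A k) F"
  by (induction k) (simp_all add: matrix_power_Suc tendsto_matrix_mult)

lemma tendsto_twist:
  fixes U P :: "complex^'n^'n"
  shows "(u \<longlongrightarrow> U) F \<Longrightarrow> (p \<longlongrightarrow> P) F \<Longrightarrow> ((\<lambda>n. twist (u n) (p n) k) \<longlongrightarrow> twist U P k) F"
  unfolding twist_def by (intro tendsto_matrix_mult tendsto_matrix_power tendsto_conj_transpose)

text \<open>Each column is the image of a unit vector and therefore has norm 1.\<close>

lemma unitary_entry_le_1: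
  assumes "unitary U"
  shows "cmod (U $ i $ j) \<le> 1"
proof -
  have "cinner (U *v axis j 1) (U *v axis j 1) = 1"
    using assms by (simp add: cinner_unitary cinner_axis_left)
  then have "(\<Sum>i\<in>UNIV. (cmod (U $ i $ j))\<^sup>2) = 1"
    by (simp only: cinner_self matrix_vector_mult_axis of_real_eq_1_iff)
  then have "(cmod (U $ i $ j))\<^sup>2 \<le> 1"
    using member_le_sum[of i UNIV "\<lambda>i. (cmod (U $ i $ j))\<^sup>2"] by simp
  then show ?thesis by (simp add: power_le_one_iff)
qed

lemma bounded_unitary: "bounded {U :: complex^'n^'n. unitary U}"
proof (rule boundedI)
  fix U :: "complex^'n^'n" assume "U \<in> {U. unitary U}"
  have "norm U \<le> (\<Sum>i\<in>UNIV. norm (U $ i))" by (simp add: norm_vec_def L2_set_le_sum)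
  also have "\<dots> \<le> (\<Sum>i\<in>UNIV. \<Sum>j\<in>UNIV. cmod (U $ i $ j))"
    by (intro sum_mono) (simp add: norm_vec_def L2_set_le_sum)
  also have "\<dots> \<le> (\<Sum>i\<in>(UNIV :: 'n set). \<Sum>j\<in>(UNIV :: 'n set). 1)"
    using \<open>U \<in> _\<close> by (intro sum_mono unitary_entry_le_1) simp
  finally show "norm U \<le> (\<Sum>i\<in>(UNIV :: 'n set). \<Sum>j\<in>(UNIV :: 'n set). 1)" .
qed

text \<open>The unitary factors have a convergent subsequence. Along it the positive factors
  converge as well, being the matrices \<open>X m\<close> times the adjoints of the unitary ones,
  and all the defining conditions are closed.\<close>

lemma commuting_polar_limit:
  fixes X :: "nat \<Rightarrow> complex^'n^'n"
  assumes X: "X \<longlonglongrightarrow> A" and polar: "\<And>m. \<exists>P U. commuting_polar (X m) P U"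
  shows "\<exists>P U. commuting_polar A P U"
proof -
  obtain p u where pu: "\<And>m. commuting_polar (X m) (p m) (u m)" using polar by metis
  then have unit: "unitary (u m)" for m by (simp add: commuting_polar_def)
  have "bounded (range u)" by (rule bounded_subset[OF bounded_unitary]) (auto simp: unit)
  then obtain U r where r: "strict_mono r" and "(u \<circ> r) \<longlonglongrightarrow> U"
    using bounded_imp_convergent_subsequence by blast
  then have U: "(\<lambda>m. u (r m)) \<longlonglongrightarrow> U" by (simp add: o_def)
  define P where "P = A ** conj_transpose U"
  have Xr: "(\<lambda>m. X (r m)) \<longlonglongrightarrow> A" using LIMSEQ_subseq_LIMSEQ[OF X r] by (simp add: o_def)
  have "p m = X m ** conj_transpose (u m)" for m
    using pu[of m] unit by (simp add: commuting_polar_def matrix_mul_assoc[symmetric] unitaryD)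
  then have P: "(\<lambda>m. p (r m)) \<longlonglongrightarrow> P"
    unfolding P_def by (simp add: tendsto_matrix_mult tendsto_conj_transpose U Xr)
  have "unitary U"
  proof -
    have "(\<lambda>m. conj_transpose (u (r m)) ** u (r m)) \<longlonglongrightarrow> conj_transpose U ** U"
      by (intro tendsto_matrix_mult tendsto_conj_transpose U)
    then have "conj_transpose U ** U = mat 1" by (simp add: unitaryD unit LIMSEQ_const_iff)
    then show ?thesis using matrix_left_right_inverse by (auto simp: unitary_def)
  qed
  moreover have "A = P ** U"
    using \<open>unitary U\<close> by (simp add: P_def matrix_mul_assoc[symmetric] unitaryD)
  moreover have "positive_semidefinite P"
    unfolding positive_semidefinite_cinner
  proof (intro conjI allI)
    have "conj_transpose (p m) = p m" for m
      using pu[of m] by (simp add: commuting_polar_def positive_semidefinite_cinner)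
    then show "conj_transpose P = P" using tendsto_conj_transpose[OF P] P LIMSEQ_unique by auto
    fix x :: "complex^'n"
    have "(\<lambda>m. Re (cinner (p (r m) *v x) x)) \<longlonglongrightarrow> Re (cinner (P *v x) x)"
      unfolding cinner_def matrix_vector_mult_def vec_lambda_beta
      by (intro tendsto_intros tendsto_vec_nth P)
    moreover have "0 \<le> Re (cinner (p m *v x) x)" for m
      using pu[of m] by (simp add: commuting_polar_def positive_semidefinite_cinner)
    ultimately show "0 \<le> Re (cinner (P *v x) x)" by (intro LIMSEQ_le_const) auto
  qed
  moreover have "commutes (twist U P k) P" for k
  proof -
    have "twist (u m) (p m) k ** p m = p m ** twist (u m) (p m) k" for m
      using pu[of m] by (simp add: commuting_polar_def commutes_def)
    then have "(\<lambda>m. p (r m) ** twist (u (r m)) (p (r m)) k) \<longlonglongrightarrow> twist U P k ** P"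
      using tendsto_matrix_mult[OF tendsto_twist[OF U P, of k] P] by simp
    moreover have "(\<lambda>m. p (r m) ** twist (u (r m)) (p (r m)) k) \<longlonglongrightarrow> P ** twist U P k"
      by (intro tendsto_matrix_mult tendsto_twist U P)
    ultimately show ?thesis unfolding commutes_def by (rule LIMSEQ_unique)
  qed
  ultimately show ?thesis unfolding commuting_polar_def by blast
qed

section \<open>Approximation by matrices with distinct singular values\<close>

lemma tendsto_add_over_Suc: "(\<lambda>m. a + c / real (Suc m)) \<longlonglongrightarrow> (a :: real)"
  using tendsto_add[OF tendsto_const LIMSEQ_Suc[OF lim_const_over_n[of c]], of a] by simp

text \<open>Two indices with equal limits are separated for every m by the distinct numbers
  \<open>e i\<close>, and two with different limits are separated for all large m. There are only
  finitely many pairs.\<close>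

lemma distinct_perturbation_eventually:
  fixes a :: "'n::finite \<Rightarrow> real" and e :: "'n \<Rightarrow> nat"
  assumes "inj e"
  shows "\<forall>\<^sub>F m in sequentially. inj (\<lambda>j. a j + real (e j) / real (Suc m))"
proof -
  note lim = tendsto_add_over_Suc
  have "\<forall>\<^sub>F m in sequentially. i \<noteq> j \<longrightarrow> a i + real (e i) / real (Suc m) \<noteq> a j + real (e j) / real (Suc m)"
    for i j
  proof (cases "a i = a j")
    case True
    then show ?thesis using assms by (auto simp: inj_eq intro!: always_eventually)
  next
    case False
    then have "\<forall>\<^sub>F m in sequentially.
        (a i + real (e i) / real (Suc m)) - (a j + real (e j) / real (Suc m)) \<noteq> 0"
      by (intro tendsto_imp_eventually_ne[OF tendsto_diff[OF lim lim]]) simp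
    then show ?thesis by (rule eventually_mono) auto
  qed
  then have "\<forall>\<^sub>F m in sequentially. \<forall>i j. i \<noteq> j \<longrightarrow>
      a i + real (e i) / real (Suc m) \<noteq> a j + real (e j) / real (Suc m)"
    by (intro eventually_all_finite)
  then show ?thesis by (rule eventually_mono) (auto simp: inj_def)
qed

lemma monomial_limit_of_distinct:
  fixes W :: "complex^'n^'n"
  assumes W: "unitary W" and \<pi>: "bij \<pi>"
    and A: "A = W ** monomial_mat \<pi> d ** conj_transpose W"
  obtains X where "\<And>m. half_normal (X m)" "\<And>m. distinct_singular_values (X m)" "X \<longlonglongrightarrow> A"
proof -
  obtain e :: "'n \<Rightarrow> nat" where "inj e" using finite_imp_inj_to_nat_seg[of "UNIV :: 'n set"] by auto
  \<comment> \<open>Only the moduli are perturbed. The phases stay fixed, with phase 1 for a zero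
    weight, and the \<open>s m j\<close> become the singular values of \<open>X m\<close>.\<close>
  define s where "s m j = cmod (d j) + real (e j) / real (Suc m)" for m j
  have s0: "0 \<le> s m j" for m j by (simp add: s_def)
  \<comment> \<open>Distinctness is guaranteed only from \<open>N\<close> on, so the final sequence
    is shifted by \<open>N\<close>.\<close>
  obtain N where N: "\<And>m. m \<ge> N \<Longrightarrow> inj (s m)"
    using distinct_perturbation_eventually[OF \<open>inj e\<close>, of "\<lambda>j. cmod (d j)"]
    unfolding eventually_sequentially s_def by blast
  define t where "t m j = complex_of_real (s m j) * phase (d j)" for m j
  define X where "X m = W ** monomial_mat \<pi> (t m) ** conj_transpose W" for m
  have X_conj: "X m = conj_transpose (conj_transpose W) ** monomial_mat \<pi> (t m) ** conj_transpose W" for m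
    by (simp add: X_def)
  note W' = unitary_conj_transpose[OF W]
  have "half_normal (X m)" for m
    unfolding X_conj by (rule half_normal_unitary_conj[OF W' half_normal_monomial_mat[OF \<pi>]])
  moreover have "distinct_singular_values (X (m + N))" for m
  proof -
    have "cmod (t m j) = s m j" for m j
      using s0[of m j] by (simp add: t_def norm_mult)
    then have "cnj (t m j) * t m j = complex_of_real ((s m j)\<^sup>2)" for m j
      by (metis complex_norm_square mult.commute)
    then have "conj_transpose (monomial_mat \<pi> (t m)) ** monomial_mat \<pi> (t m)
        = diag_mat (\<lambda>j. complex_of_real ((s m j)\<^sup>2))" for m
      using \<pi> by (simp add: conj_transpose_monomial_mat monomial_mat_mult bij_is_inj inv_o_cancel)
    then have "conj_transpose (X m) ** X m
        = W ** diag_mat (\<lambda>j. complex_of_real ((s m j)\<^sup>2)) ** conj_transpose W" for m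
      unfolding X_conj gram_unitary_conj(1)[OF W'] by simp
    from distinct_singular_values_iff[OF W s0 this] show ?thesis using N[of "m + N"] by simp
  qed
  moreover have "X \<longlonglongrightarrow> A"
  proof -
    have "(\<lambda>m. s m j) \<longlonglongrightarrow> cmod (d j)" for j
      unfolding s_def by (rule tendsto_add_over_Suc)
    then have "(\<lambda>m. t m j) \<longlonglongrightarrow> complex_of_real (cmod (d j)) * phase (d j)" for j
      unfolding t_def by (intro tendsto_intros)
    then have "(\<lambda>m. t m j) \<longlonglongrightarrow> d j" for j by (simp only: cmod_times_phase)
    then have "(\<lambda>m. monomial_mat \<pi> (t m)) \<longlonglongrightarrow> monomial_mat \<pi> d"
      unfolding monomial_mat_def by (intro tendsto_vec_lambda) (simp split: if_split)
    then show ?thesis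
      unfolding X_def A by (intro tendsto_matrix_mult tendsto_const)
  qed
  then have "(\<lambda>m. X (m + N)) \<longlonglongrightarrow> A" by (rule LIMSEQ_ignore_initial_segment)
  ultimately show thesis using that[of "\<lambda>m. X (m + N)"] by blast
qed

theorem theorem9:
  fixes A :: "complex^'n^'n"
  assumes "half_normal A"
  shows "((\<exists>B. weighted_permutation B \<and> unitarily_equivalent A B)
            \<longleftrightarrow>
          (\<exists>X :: nat \<Rightarrow> complex^'n^'n.
             (\<forall>m. half_normal (X m) \<and> distinct_singular_values (X m)) \<and> X \<longlonglongrightarrow> A))
       \<and> ((\<exists>X :: nat \<Rightarrow> complex^'n^'n.
             (\<forall>m. half_normal (X m) \<and> distinct_singular_values (X m)) \<and> X \<longlonglongrightarrow> A)
            \<longleftrightarrow>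
          (\<exists>P U. positive_semidefinite P \<and> unitary U \<and> A = P ** U \<and>
             (\<forall>k. commutes (matrix_power (conj_transpose U) k ** P ** matrix_power U k) P)))"
    (is "(?perm \<longleftrightarrow> ?lim) \<and> (?lim \<longleftrightarrow> ?polar)")
proof -
  have polar: "?polar \<longleftrightarrow> (\<exists>P U. commuting_polar A P U)"
    by (simp add: commuting_polar_def twist_def)
  \<comment> \<open>Solving for \<open>A\<close> brings a weighted permutation form into the shape
    used by the constructions for (2) and (3).\<close>
  have monomial: "\<exists>\<pi> d. bij \<pi> \<and> A = W ** monomial_mat \<pi> d ** conj_transpose W"
    if "unitary W" "weighted_permutation (conj_transpose W ** A ** W)" for A W :: "complex^'n^'n"
    using that by (metis weighted_permutation_iff_monomial unitary_conj_eq_iff)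
  have "?lim" if "?perm"
  proof -
    obtain W where "unitary W" "weighted_permutation (conj_transpose W ** A ** W)"
      using \<open>?perm\<close> by (auto simp: unitarily_equivalent_def)
    with monomial show ?thesis using monomial_limit_of_distinct by metis
  qed
  moreover have "?polar" if "?lim"
  proof -
    obtain X where X: "\<And>m. half_normal (X m)" "\<And>m. distinct_singular_values (X m)" "X \<longlonglongrightarrow> A"
      using \<open>?lim\<close> by blast
    have "\<exists>P U. commuting_polar (X m) P U" for m
    proof -
      obtain W where W: "unitary W" "weighted_permutation (conj_transpose W ** X m ** W)"
        using distinct_half_normal_weighted_permutation[OF X(1,2)] by blast
      with monomial[OF W] show ?thesis using monomial_commuting_polar by blast
    qed
    then show ?thesis unfolding polar by (rule commuting_polar_limit[OF X(3)])
  qed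
  moreover have "?perm" if "?polar"
  proof -
    obtain P U where "commuting_polar A P U" using \<open>?polar\<close> polar by blast
    then obtain W where "unitary W" "weighted_permutation (conj_transpose W ** A ** W)"
      by (rule commuting_polar_weighted_permutation)
    then show ?thesis unfolding unitarily_equivalent_def by blast
  qed
  ultimately show ?thesis by argo
qed

end
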